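(* Let $k\ge1$. For solvable Leibniz algebras $R$ over $\mathbb{C}$ whose nilradical is the $k$-dimensional abelian algebra $\mathcal{A}(k)$, let $s=\dim R-k$ be the dimension of a complementary space of the nilradical. Then the maximal possible dimension of such an algebra $R$ is $2k$, that is, the maximal possible value of $s$ is $k$. Moreover, every solvable Leibniz algebra with nilradical $\mathcal{A}(k)$ and $s=k$ decomposes as a direct sum of two-dimensional non-nilpotent solvable Leibniz algebras (not necessarily isomorphic to one another).
   Context: All algebras are finite-dimensional over $\mathbb{C}$. A (right) Leibniz algebra is a vector space $L$ with a bilinear bracket satisfying $[x,[y,z]]=[[x,y],z]-[[x,z],y]$ for all $x,y,z\in L$. $L$ is nilpotent if its lower central series $L^1=L$, $L^{j+1}=[L^j,L]$ reaches $0$; it is solvable if its derived series $L^{[1]}=L$, $L^{[j+1]}=[L^{[j]},L^{[j]}]$ reaches $0$. The nilradical is the maximal nilpotent ideal. $\mathcal{A}(k)$ denotes the $k$-dimensional algebra with zero bracket. A direct sum of Leibniz algebras is the vector space direct sum with componentwise bracket. *)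

theory Defs
  imports Complex_Main "HOL-Library.FuncSet" "HOL-Library.Function_Algebras"
begin

text \<open>An algebra is a finite-dimensional subspace \<open>L\<close> of an ambient complex vector space
  together with a bracket that is only constrained on \<open>L\<close>. In this way ideals, subalgebras and
  direct summands are again algebras for the same bracket.\<close>

locale leibniz_algebra = vector_space scale
  for scale :: "complex \<Rightarrow> 'a::ab_group_add \<Rightarrow> 'a" +
  fixes br :: "'a \<Rightarrow> 'a \<Rightarrow> 'a" and L :: "'a set"
  assumes finite_dimensional: "\<exists>B. finite B \<and> span B = L"
    and bracket_closed: "x \<in> L \<Longrightarrow> y \<in> L \<Longrightarrow> br x y \<in> L"
    and bracket_add_left: "x \<in> L \<Longrightarrow> y \<in> L \<Longrightarrow> z \<in> L \<Longrightarrow> br (x + y) z = br x z + br y z"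
    and bracket_add_right: "x \<in> L \<Longrightarrow> y \<in> L \<Longrightarrow> z \<in> L \<Longrightarrow> br x (y + z) = br x y + br x z"
    and bracket_scale_left: "x \<in> L \<Longrightarrow> y \<in> L \<Longrightarrow> br (scale c x) y = scale c (br x y)"
    and bracket_scale_right: "x \<in> L \<Longrightarrow> y \<in> L \<Longrightarrow> br x (scale c y) = scale c (br x y)"
    and leibniz_identity: "x \<in> L \<Longrightarrow> y \<in> L \<Longrightarrow> z \<in> L \<Longrightarrow>
      br x (br y z) = br (br x y) z - br (br x z) y"

text \<open>A separate locale: the interpretation of \<open>vector_space\<close> for real vector spaces would
  otherwise shadow the constants below during their own definition.\<close>

locale complex_vector_space = vector_space scale
  for scale :: "complex \<Rightarrow> 'b::ab_group_add \<Rightarrow> 'b"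
begin

definition bracket_span :: "('b \<Rightarrow> 'b \<Rightarrow> 'b) \<Rightarrow> 'b set \<Rightarrow> 'b set \<Rightarrow> 'b set" where
  "bracket_span br A B = span {br x y | x y. x \<in> A \<and> y \<in> B}"

text \<open>Both series are indexed from 0, so that index \<open>j\<close> stands for \<open>L\<close> with superscript \<open>j + 1\<close>.\<close>

primrec lower_central :: "('b \<Rightarrow> 'b \<Rightarrow> 'b) \<Rightarrow> 'b set \<Rightarrow> nat \<Rightarrow> 'b set" where
  "lower_central br L 0 = L"
| "lower_central br L (Suc j) = bracket_span br (lower_central br L j) L"

primrec derived :: "('b \<Rightarrow> 'b \<Rightarrow> 'b) \<Rightarrow> 'b set \<Rightarrow> nat \<Rightarrow> 'b set" where
  "derived br L 0 = L"
| "derived br L (Suc j) = bracket_span br (derived br L j) (derived br L j)"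

definition nilpotent :: "('b \<Rightarrow> 'b \<Rightarrow> 'b) \<Rightarrow> 'b set \<Rightarrow> bool" where
  "nilpotent br L \<longleftrightarrow> (\<exists>j. lower_central br L j = {0})"

definition solvable :: "('b \<Rightarrow> 'b \<Rightarrow> 'b) \<Rightarrow> 'b set \<Rightarrow> bool" where
  "solvable br L \<longleftrightarrow> (\<exists>j. derived br L j = {0})"

definition ideal_of :: "('b \<Rightarrow> 'b \<Rightarrow> 'b) \<Rightarrow> 'b set \<Rightarrow> 'b set \<Rightarrow> bool" where
  "ideal_of br L J \<longleftrightarrow> subspace J \<and> J \<subseteq> L \<and> (\<forall>x\<in>J. \<forall>y\<in>L. br x y \<in> J \<and> br y x \<in> J)"

definition is_nilradical :: "('b \<Rightarrow> 'b \<Rightarrow> 'b) \<Rightarrow> 'b set \<Rightarrow> 'b set \<Rightarrow> bool" where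
  "is_nilradical br L N \<longleftrightarrow> ideal_of br L N \<and> nilpotent br N \<and>
     (\<forall>J. ideal_of br L J \<and> nilpotent br J \<longrightarrow> J \<subseteq> N)"

text \<open>\<open>N\<close> is a copy of the \<open>k\<close>-dimensional algebra with zero bracket.\<close>

definition is_abelian_algebra :: "nat \<Rightarrow> ('b \<Rightarrow> 'b \<Rightarrow> 'b) \<Rightarrow> 'b set \<Rightarrow> bool" where
  "is_abelian_algebra k br N \<longleftrightarrow> subspace N \<and> dim N = k \<and> (\<forall>x\<in>N. \<forall>y\<in>N. br x y = 0)"

text \<open>Summation identifies the external direct sum of the \<open>M i\<close>, with componentwise bracket,
  with \<open>L\<close>.\<close>

definition is_direct_sum :: "('b \<Rightarrow> 'b \<Rightarrow> 'b) \<Rightarrow> 'b set \<Rightarrow> 'i set \<Rightarrow> ('i \<Rightarrow> 'b set) \<Rightarrow> bool" where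
  "is_direct_sum br L I M \<longleftrightarrow> finite I \<and> (\<forall>i\<in>I. subspace (M i)) \<and>
     bij_betw (\<lambda>x. \<Sum>i\<in>I. x i) (Pi\<^sub>E I M) L \<and>
     (\<forall>x \<in> Pi\<^sub>E I M. \<forall>y \<in> Pi\<^sub>E I M.
        br (\<Sum>i\<in>I. x i) (\<Sum>i\<in>I. y i) = (\<Sum>i\<in>I. br (x i) (y i)))"

end

definition solvable_with_abelian_nilradical ::
    "nat \<Rightarrow> (complex \<Rightarrow> 'a::ab_group_add \<Rightarrow> 'a) \<Rightarrow> ('a \<Rightarrow> 'a \<Rightarrow> 'a) \<Rightarrow> 'a set \<Rightarrow> bool" where
  "solvable_with_abelian_nilradical k scale br R \<longleftrightarrow>
     leibniz_algebra scale br R \<and> complex_vector_space.solvable scale br R \<and>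
     (\<exists>N. complex_vector_space.is_nilradical scale br R N \<and>
          complex_vector_space.is_abelian_algebra scale k br N)"

text \<open>The dimension \<open>s\<close> of a complement of a \<open>k\<close>-dimensional nilradical, as an integer to
  avoid truncated subtraction.\<close>

definition complement_dim ::
    "nat \<Rightarrow> (complex \<Rightarrow> 'a::ab_group_add \<Rightarrow> 'a) \<Rightarrow> 'a set \<Rightarrow> int" where
  "complement_dim k scale R = int (vector_space.dim scale R) - int k"

end

theory Submission
  imports Defs "HOL-Computational_Algebra.Fundamental_Theorem_Algebra"
begin

text \<open>
  Throughout, \<open>R\<close> is the solvable Leibniz algebra, \<open>N\<close> its abelian nilradical of dimension \<open>k\<close>,
  and an element \<open>x\<close> of \<open>R\<close> acts on \<open>N\<close> by right multiplication \<open>n \<mapsto> [n, x]\<close>. The Leibniz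
  identity says that \<open>[x, y]\<close> acts as a commutator of the actions of \<open>x\<close> and \<open>y\<close>; since \<open>N\<close> is
  abelian, \<open>N\<close> acts trivially.

  A criterion for membership in \<open>N\<close> drives everything (\<open>ideal_sub_nilradical\<close>): an ideal \<open>J\<close> with
  \<open>[J, J] \<subseteq> N\<close> that is spanned by elements acting nilpotently on \<open>N\<close> is a nilpotent ideal, hence
  contained in \<open>N\<close>. Indeed the actions of \<open>J\<close> commute, so they are triangular in a common basis of
  \<open>N\<close>, with zero diagonal, and the lower central series of \<open>J\<close> descends along the flag.

  The first consequence is \<open>[R, R] \<subseteq> N\<close> (\<open>derived_in_nilradical\<close>). Otherwise let \<open>D\<close> be the last
  term of the derived series of \<open>R\<close> that is not in \<open>N\<close>. By Jacobson's lemma, a commutator that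
  commutes with one of its two entries is nilpotent. It shows that \<open>[d, x]\<close> acts nilpotently for
  \<open>d\<close> in \<open>D\<close> and \<open>x\<close> in \<open>R\<close>, so \<open>[D, R]\<close> and \<open>[R, D]\<close> lie in \<open>N\<close>; then \<open>D\<close> acts centrally and
  is itself spanned by brackets, so Jacobson's lemma applies again and puts \<open>D\<close> into \<open>N\<close>.

  Now all of \<open>R\<close> is simultaneously triangular on \<open>N\<close>. The \<open>k\<close> diagonal entries are linear
  functionals on \<open>R\<close>, the weights, and by the criterion an element on which all weights vanish lies
  in \<open>N\<close>. Hence \<open>dim R - k \<le> k\<close>.

  If equality holds, the weights are linearly independent, so there are elements \<open>x i\<close> dual to them
  and \<open>N\<close> has a basis of common eigenvectors \<open>e i\<close>. The element \<open>t = \<Sum>i. x i\<close> acts on \<open>N\<close> as the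
  identity. Replacing \<open>x i\<close> by \<open>x i - [x i, t]\<close> makes \<open>t\<close> annihilate it from the right, and as right
  multiplication by \<open>t\<close> is a derivation, all brackets between the new elements are elements of \<open>N\<close>
  killed by \<open>t\<close>, that is, zero. The Leibniz identity forces the left products of these elements
  with \<open>e j\<close> to vanish off the diagonal, and \<open>R\<close> is the direct sum of the spans of \<open>e i\<close> and the
  corrected \<open>x i\<close>.
\<close>

section \<open>Endomorphisms of a subspace and polynomials in them\<close>

context complex_vector_space
begin

text \<open>The bracket is linear only on the algebra, so linearity is required on a subspace alone.\<close>

definition endomorphism_on :: "'b set \<Rightarrow> ('b \<Rightarrow> 'b) \<Rightarrow> bool" where
  "endomorphism_on U f \<longleftrightarrow> (\<forall>u\<in>U. f u \<in> U) \<and> (\<forall>u\<in>U. \<forall>v\<in>U. f (u + v) = f u + f v) \<and>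
     (\<forall>c. \<forall>v\<in>U. f (scale c v) = scale c (f v))"

lemma endomorphism_onD:
  assumes "endomorphism_on U f"
  shows "u \<in> U \<Longrightarrow> f u \<in> U"
    and "u \<in> U \<Longrightarrow> v \<in> U \<Longrightarrow> f (u + v) = f u + f v"
    and "v \<in> U \<Longrightarrow> f (scale c v) = scale c (f v)"
  using assms unfolding endomorphism_on_def by blast+

lemma endomorphism_on_diff:
  assumes "endomorphism_on U f" "subspace U" "u \<in> U" "v \<in> U"
  shows "f (u - v) = f u - f v"
proof -
  have "f (u - v + v) = f (u - v) + f v"
    using assms subspace_diff by (intro endomorphism_onD(2)[OF assms(1)]) auto
  then show ?thesis by simp
qed

lemma endomorphism_on_zero:
  assumes "endomorphism_on U f" "subspace U"
  shows "f 0 = 0"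
  using endomorphism_on_diff[OF assms subspace_0 subspace_0, OF assms(2) assms(2)] by simp

lemma endomorphism_on_subset:
  assumes "endomorphism_on U f" "V \<subseteq> U" "\<And>v. v \<in> V \<Longrightarrow> f v \<in> V"
  shows "endomorphism_on V f"
  using assms unfolding endomorphism_on_def by blast

lemma endomorphism_on_funpow:
  assumes "endomorphism_on U f"
  shows "endomorphism_on U (f ^^ m)"
  using assms by (induction m) (auto simp: endomorphism_on_def)

text \<open>The vector \<open>p(f) v\<close>, evaluated by the Horner scheme.\<close>

definition poly_apply :: "('b \<Rightarrow> 'b) \<Rightarrow> complex poly \<Rightarrow> 'b \<Rightarrow> 'b" where
  "poly_apply f p v = fold_coeffs (\<lambda>a w. scale a v + f w) p 0"

lemma poly_apply_0 [simp]: "poly_apply f 0 v = 0"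
  by (simp add: poly_apply_def)

lemma poly_apply_pCons:
  assumes "f 0 = 0"
  shows "poly_apply f (pCons a p) v = scale a v + f (poly_apply f p v)"
  using assms by (cases "p = 0 \<and> a = 0") (auto simp: poly_apply_def)

context
  fixes U f
  assumes sub: "subspace U" and endo: "endomorphism_on U f"
begin

lemmas poly_apply_step = poly_apply_pCons[of f, OF endomorphism_on_zero[OF endo sub]]

lemma poly_apply_closed: "v \<in> U \<Longrightarrow> poly_apply f p v \<in> U"
  by (induction p)
    (auto simp: poly_apply_step subspace_0[OF sub]
      intro!: subspace_add[OF sub] subspace_scale[OF sub] endomorphism_onD(1)[OF endo])

lemma poly_apply_add:
  assumes "v \<in> U"
  shows "poly_apply f (p + q) v = poly_apply f p v + poly_apply f q v"
proof (induction p q rule: poly_induct2)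
  case (pCons a p b q)
  then show ?case
    using assms endomorphism_onD(2)[OF endo] poly_apply_closed
    by (simp add: poly_apply_step scale_left_distrib algebra_simps)
qed simp

lemma poly_apply_smult:
  assumes "v \<in> U"
  shows "poly_apply f (smult c p) v = scale c (poly_apply f p v)"
proof (induction p)
  case (pCons a p)
  then show ?case
    using assms endomorphism_onD(3)[OF endo] poly_apply_closed
    by (simp add: poly_apply_step scale_right_distrib)
qed simp

lemma poly_apply_diff:
  assumes "v \<in> U"
  shows "poly_apply f (p - q) v = poly_apply f p v - poly_apply f q v"
  using poly_apply_add[OF assms, of "p - q" q] by simp

lemma poly_apply_const: "poly_apply f [:c:] v = scale c v"
  by (simp add: poly_apply_step endomorphism_on_zero[OF endo sub])

lemma poly_apply_mult:
  assumes "v \<in> U"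
  shows "poly_apply f (p * q) v = poly_apply f p (poly_apply f q v)"
proof (induction p)
  case (pCons a p)
  then show ?case
    by (simp add: poly_apply_step poly_apply_add[OF assms] poly_apply_smult[OF assms])
qed simp

lemma poly_apply_zero [simp]: "poly_apply f p 0 = 0"
  by (induction p) (simp_all add: poly_apply_step endomorphism_on_zero[OF endo sub])

lemma poly_apply_monom:
  assumes "v \<in> U"
  shows "poly_apply f (monom 1 n) v = (f ^^ n) v"
proof (induction n)
  case 0
  then show ?case using poly_apply_const[of 1 v] by (simp add: monom_0)
next
  case (Suc n)
  then show ?case by (simp add: monom_Suc poly_apply_step)
qed

lemma poly_apply_commute:
  assumes g: "endomorphism_on U g" and comm: "\<And>w. w \<in> U \<Longrightarrow> f (g w) = g (f w)" and v: "v \<in> U"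
  shows "poly_apply f p (g v) = g (poly_apply f p v)"
proof (induction p)
  case 0
  then show ?case using endomorphism_on_zero[OF g sub] by simp
next
  case (pCons a p)
  have "poly_apply f p v \<in> U" using v poly_apply_closed by blast
  then show ?case
    using pCons v comm endomorphism_onD[OF g] endomorphism_onD(1)[OF endo] sub
    by (simp add: poly_apply_step subspace_scale)
qed

text \<open>Some power \<open>f^n v\<close> lies in the span of the lower ones, because \<open>U\<close> is finite-dimensional;
  the span of the lower powers consists of the \<open>q(f) v\<close> with \<open>q\<close> of degree below \<open>n\<close>.\<close>

lemma ex_annihilating_poly_vector:
  assumes fin: "finite B" "U \<subseteq> span B" and v: "v \<in> U"
  shows "\<exists>p. p \<noteq> 0 \<and> poly_apply f p v = 0"
proof -
  have pow: "(f ^^ n) v \<in> U" for n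
    using endomorphism_on_funpow[OF endo, of n] v unfolding endomorphism_on_def by blast
  define orb where "orb n = (\<lambda>i. (f ^^ i) v) ` {..<n}" for n
  have "\<exists>n. (f ^^ n) v \<in> span (orb n)"
  proof (rule ccontr)
    assume "\<not> ?thesis"
    then have notin: "(f ^^ n) v \<notin> span (orb n)" for n by blast
    have orb_Suc: "orb (Suc n) = insert ((f ^^ n) v) (orb n)" for n
      by (simp add: orb_def lessThan_Suc)
    have ind: "independent (orb n) \<and> card (orb n) = n" for n
    proof (induction n)
      case 0
      then show ?case by (simp add: orb_def independent_empty)
    next
      case (Suc n)
      have "(f ^^ n) v \<notin> orb n" using notin[of n] span_base by metis
      moreover have "finite (orb n)" by (simp add: orb_def)
      ultimately show ?case using Suc notin[of n] by (simp add: orb_Suc independent_insertI)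
    qed
    have "orb n \<subseteq> span B" for n using fin(2) pow by (auto simp: orb_def)
    then have "card (orb (Suc (card B))) \<le> card B"
      using independent_span_bound[OF fin(1)] ind by blast
    then show False using ind[of "Suc (card B)"] by simp
  qed
  then obtain n where n: "(f ^^ n) v \<in> span ((\<lambda>i. (f ^^ i) v) ` {..<n})"
    unfolding orb_def by blast
  have "span ((\<lambda>i. (f ^^ i) v) ` {..<n}) \<subseteq> (\<lambda>q. poly_apply f q v) ` {q. \<forall>i\<ge>n. coeff q i = 0}"
  proof (rule span_minimal)
    show "(\<lambda>i. (f ^^ i) v) ` {..<n} \<subseteq> (\<lambda>q. poly_apply f q v) ` {q. \<forall>i\<ge>n. coeff q i = 0}"
      by (auto intro!: image_eqI[of _ _ "monom 1 _"] simp: poly_apply_monom[OF v])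
    show "subspace ((\<lambda>q. poly_apply f q v) ` {q. \<forall>i\<ge>n. coeff q i = 0})"
    proof (rule subspaceI; (elim imageE)?)
      show "0 \<in> (\<lambda>q. poly_apply f q v) ` {q. \<forall>i\<ge>n. coeff q i = 0}"
        by (intro image_eqI[of _ _ 0]) auto
    next
      fix x y p q
      assume "x = poly_apply f p v" "p \<in> {q. \<forall>i\<ge>n. coeff q i = 0}"
        "y = poly_apply f q v" "q \<in> {q. \<forall>i\<ge>n. coeff q i = 0}"
      then show "x + y \<in> (\<lambda>q. poly_apply f q v) ` {q. \<forall>i\<ge>n. coeff q i = 0}"
        by (intro image_eqI[of _ _ "p + q"]) (auto simp: poly_apply_add[OF v])
    next
      fix c x p
      assume "x = poly_apply f p v" "p \<in> {q. \<forall>i\<ge>n. coeff q i = 0}"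
      then show "scale c x \<in> (\<lambda>q. poly_apply f q v) ` {q. \<forall>i\<ge>n. coeff q i = 0}"
        by (intro image_eqI[of _ _ "smult c p"]) (auto simp: poly_apply_smult[OF v])
    qed
  qed
  with n obtain q where q: "(f ^^ n) v = poly_apply f q v" "\<forall>i\<ge>n. coeff q i = 0" by blast
  have "coeff (monom 1 n - q) n \<noteq> 0" using q(2) by simp
  then have "monom 1 n - q \<noteq> 0" by (metis coeff_0)
  moreover have "poly_apply f (monom 1 n - q) v = 0"
    by (simp add: poly_apply_diff[OF v] poly_apply_monom[OF v] q(1))
  ultimately show ?thesis by blast
qed

text \<open>The product of annihilating polynomials for the members of a spanning set annihilates all
  of \<open>U\<close>.\<close>

lemma ex_annihilating_poly:
  assumes "finite B" "U = span B"
  shows "\<exists>p. p \<noteq> 0 \<and> (\<forall>v\<in>U. poly_apply f p v = 0)"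
proof -
  have BU: "B \<subseteq> U" using assms span_superset by blast
  have "\<exists>p. p \<noteq> 0 \<and> (\<forall>v\<in>A. poly_apply f p v = 0)" if "finite A" "A \<subseteq> B" for A
    using that
  proof (induction A)
    case (insert b A)
    then obtain p where p: "p \<noteq> 0" "\<forall>v\<in>A. poly_apply f p v = 0" by auto
    have b: "b \<in> U" using insert BU by blast
    obtain q where q: "q \<noteq> 0" "poly_apply f q b = 0"
      using ex_annihilating_poly_vector[OF assms(1) _ b] assms(2) by auto
    have "poly_apply f (p * q) v = 0" if "v \<in> insert b A" for v
    proof (cases "v = b")
      case True
      then show ?thesis using poly_apply_mult[OF b] q by simp
    next
      case False
      then have "v \<in> A" "v \<in> U" using that insert BU by auto
      then show ?thesis using poly_apply_mult[of v q p] p by (simp add: mult.commute)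
    qed
    then show ?case using p q by (intro exI[of _ "p * q"]) auto
  qed (auto intro: exI[of _ 1])
  then obtain p where p: "p \<noteq> 0" "\<forall>v\<in>B. poly_apply f p v = 0" using assms(1) by blast
  have lin: "poly_apply f p (scale c x + y) = scale c (poly_apply f p x) + poly_apply f p y"
    if "x \<in> U" "y \<in> U" for c x y
  proof (induction p)
    case (pCons a p)
    have "f (scale c (poly_apply f p x) + poly_apply f p y) =
        scale c (f (poly_apply f p x)) + f (poly_apply f p y)"
      using that endomorphism_onD[OF endo] poly_apply_closed subspace_scale[OF sub] by simp
    then show ?case using pCons
      by (simp add: poly_apply_step algebra_simps scale_left_commute scale_right_distrib)
  qed simp
  have "subspace {v \<in> U. poly_apply f p v = 0}"
    using lin[of _ _ 1] lin[of _ 0] subspace_0[OF sub]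
    by (intro subspaceI) (auto intro: subspace_add[OF sub] subspace_scale[OF sub])
  then have "span B \<subseteq> {v \<in> U. poly_apply f p v = 0}"
    using p BU by (intro span_minimal) auto
  then show ?thesis using p(1) assms(2) by blast
qed

text \<open>This is the existence of an eigenvector in the quotient of \<open>U\<close> by \<open>W\<close>, stated without forming
  the quotient. For \<open>u\<close> outside \<open>W\<close> take \<open>p\<close> of least degree with \<open>p(f) u\<close> in \<open>W\<close>; splitting off a
  linear factor leaves \<open>q(f) u\<close> outside \<open>W\<close>.\<close>

lemma ex_relative_eigenvector:
  assumes fin: "finite B" "U \<subseteq> span B"
    and W: "subspace W" "W \<subset> U"
  shows "\<exists>c. \<exists>v\<in>U. v \<notin> W \<and> f v - scale c v \<in> W"
proof -
  obtain u where u: "u \<in> U" "u \<notin> W" using W by blast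
  have "\<exists>p. p \<noteq> 0 \<and> poly_apply f p u \<in> W"
    using ex_annihilating_poly_vector[OF fin u(1)] subspace_0[OF W(1)] by metis
  then obtain p0 where "p0 \<noteq> 0 \<and> poly_apply f p0 u \<in> W" by blast
  from ex_has_least_nat[of "\<lambda>p. p \<noteq> 0 \<and> poly_apply f p u \<in> W" _ degree, OF this]
  obtain p where p: "p \<noteq> 0" "poly_apply f p u \<in> W"
    and "\<And>q. q \<noteq> 0 \<and> poly_apply f q u \<in> W \<Longrightarrow> degree p \<le> degree q" by blast
  then have least: "degree q < degree p \<Longrightarrow> q \<noteq> 0 \<Longrightarrow> poly_apply f q u \<notin> W" for q
    using leD by blast
  have "degree p > 0"
  proof (rule ccontr)
    assume "\<not> degree p > 0"
    then obtain a where a: "p = [:a:]" using degree_eq_zeroE by blast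
    then have "scale (inverse a) (scale a u) \<in> W"
      using p poly_apply_const[of a u] subspace_scale[OF W(1), of "scale a u" "inverse a"] by simp
    then show False using a p u by simp
  qed
  then obtain c where "poly p c = 0" using alg_closed_imp_poly_has_root by blast
  then obtain q where q: "p = [:-c, 1:] * q" using poly_eq_0_iff_dvd by blast
  have "q \<noteq> 0" using p q by auto
  then have "degree q < degree p" unfolding q by (subst degree_mult_eq) auto
  then have "poly_apply f q u \<notin> W" using least \<open>q \<noteq> 0\<close> by blast
  moreover have "poly_apply f p u = f (poly_apply f q u) - scale c (poly_apply f q u)"
    unfolding q poly_apply_mult[OF u(1), of "[:-c, 1:]"]
    by (simp add: poly_apply_step endomorphism_on_zero[OF endo sub])
  ultimately show ?thesis using p(2) poly_apply_closed[OF u(1)] by metis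
qed

end

text \<open>The ambient space may have infinite dimension, so only subspaces of a finitely spanned one are
  compared.\<close>

lemma dim_psubset_of_finite:
  assumes "subspace W" "W \<subset> U" "finite B" "U \<subseteq> span B"
  shows "dim W < dim U"
proof -
  obtain C where C: "C \<subseteq> W" "independent C" "W \<subseteq> span C" "card C = dim W" using basis_exists by blast
  obtain u where u: "u \<in> U" "u \<notin> W" using assms by blast
  have "u \<notin> span C" using u C(1) assms(1) span_minimal by blast
  then have ind: "independent (insert u C)" using C by (simp add: independent_insertI)
  obtain D where D: "insert u C \<subseteq> D" "D \<subseteq> U" "independent D" "U \<subseteq> span D"
    using maximal_independent_subset_extend[OF _ ind, of U] u C(1) assms(2) by blast
  have "finite D" using independent_span_bound[OF assms(3) D(3)] D(2) assms(4) by blast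
  then have "card (insert u C) \<le> card D" using D(1) by (rule card_mono)
  moreover have "finite C" using \<open>finite D\<close> D(1) finite_subset[of C D] by simp
  moreover have "card D = dim U" using basis_card_eq_dim[OF D(2,4,3)] .
  moreover have "u \<notin> C" using \<open>u \<notin> span C\<close> span_base by blast
  ultimately show ?thesis using C(4) by simp
qed

text \<open>Each functional costs at most one additional spanning vector, on which it does not vanish.\<close>

lemma span_common_kernel:
  assumes "finite I" "subspace P"
    and "\<And>i x y. i \<in> I \<Longrightarrow> x \<in> P \<Longrightarrow> y \<in> P \<Longrightarrow> h i (x + y) = h i x + h i y"
    and "\<And>i x c. i \<in> I \<Longrightarrow> x \<in> P \<Longrightarrow> h i (scale c x) = c * (h i x :: complex)"
  shows "\<exists>Y. finite Y \<and> card Y \<le> card I \<and> P \<subseteq> span (Y \<union> {x \<in> P. \<forall>i\<in>I. h i x = 0})"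
  using assms
proof (induction I)
  case empty
  then show ?case by (intro exI[of _ "{}"]) (auto intro: span_base)
next
  case (insert i I)
  define K where "K = {x \<in> P. \<forall>j\<in>I. h j x = 0}"
  define K' where "K' = {x \<in> P. \<forall>j\<in>insert i I. h j x = 0}"
  have lin: "h j (x - scale c y) = h j x - c * h j y" if "j \<in> insert i I" "x \<in> P" "y \<in> P" for j x y c
  proof -
    have "h j (x - scale c y) = h j (x + scale (- c) y)" by simp
    also have "\<dots> = h j x + - c * h j y"
      using insert.prems that subspace_scale[of P y "- c"] by metis
    finally show ?thesis by simp
  qed
  obtain Y where Y: "finite Y" "card Y \<le> card I" "P \<subseteq> span (Y \<union> K)"
    using insert by (auto simp: K_def)
  have "\<exists>y. K \<subseteq> span (insert y K')"
  proof (cases "\<exists>y\<in>K. h i y \<noteq> 0")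
    case True
    then obtain y where y: "y \<in> K" "h i y \<noteq> 0" by blast
    have "x \<in> span (insert y K')" if x: "x \<in> K" for x
    proof -
      have "x - scale (h i x / h i y) y \<in> K'"
        using x y lin insert.prems(1) by (auto simp: K_def K'_def subspace_diff subspace_scale)
      then show ?thesis using span_base span_breakdown_eq by metis
    qed
    then show ?thesis by blast
  next
    case False
    then have "K \<subseteq> K'" by (auto simp: K_def K'_def)
    then show ?thesis using span_superset by fastforce
  qed
  then obtain y where y: "K \<subseteq> span (insert y K')" by blast
  have "Y \<union> K \<subseteq> span (insert y Y \<union> K')"
    using y span_mono[of "insert y K'" "insert y Y \<union> K'"] span_superset[of "insert y Y \<union> K'"] by blast
  then have "P \<subseteq> span (insert y Y \<union> K')" using Y(3) span_minimal subspace_span by blast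
  moreover have "card (insert y Y) \<le> card (insert i I)"
    using insert.hyps Y card_insert_le_m1[of "Suc (card I)" Y y] by simp
  ultimately show ?case using Y(1) unfolding K'_def by blast
qed

text \<open>Let \<open>U\<close> be a minimal invariant subspace strictly above \<open>W\<close>. For each member \<open>f\<close> of the family
  the vectors of \<open>U\<close> that are eigenvectors modulo \<open>W\<close> for one eigenvalue of \<open>f\<close> form a subspace,
  which is invariant because the family commutes; by minimality it is all of \<open>U\<close>.\<close>

lemma ex_common_relative_eigenvector:
  assumes N: "subspace N" and fin: "finite B" "N \<subseteq> span B"
    and endo: "\<And>f. f \<in> F \<Longrightarrow> endomorphism_on N f"
    and comm: "\<And>f g v. f \<in> F \<Longrightarrow> g \<in> F \<Longrightarrow> v \<in> N \<Longrightarrow> f (g v) = g (f v)"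
    and W: "subspace W" "W \<subset> N" "\<And>f v. f \<in> F \<Longrightarrow> v \<in> W \<Longrightarrow> f v \<in> W"
  shows "\<exists>v\<in>N. v \<notin> W \<and> (\<forall>f\<in>F. \<exists>c. f v - scale c v \<in> W)"
proof -
  define P where "P U \<longleftrightarrow> subspace U \<and> W \<subset> U \<and> U \<subseteq> N \<and> (\<forall>f\<in>F. \<forall>v\<in>U. f v \<in> U)" for U
  have "P N" using N W endomorphism_onD(1)[OF endo] by (auto simp: P_def)
  then obtain U where U: "P U" and least: "\<And>U'. P U' \<Longrightarrow> dim U \<le> dim U'"
    using ex_has_least_nat[of P N dim] by blast
  have "\<exists>c. \<forall>u\<in>U. f u - scale c u \<in> W" if f: "f \<in> F" for f
  proof -
    have endoU: "endomorphism_on U f"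
      using U f endomorphism_on_subset[OF endo[OF f], of U] by (auto simp: P_def)
    have subU: "subspace U" using U by (simp add: P_def)
    obtain c v where v: "v \<in> U" "v \<notin> W" "f v - scale c v \<in> W"
      using ex_relative_eigenvector[OF subU endoU fin(1) _ W(1)] U fin(2) unfolding P_def by blast
    define E where "E = {u \<in> U. f u - scale c u \<in> W}"
    have EU: "E \<subseteq> U" by (auto simp: E_def)
    have "subspace E"
    proof (rule subspaceI)
      show "0 \<in> E" using subspace_0[OF subU] subspace_0[OF W(1)] endomorphism_on_zero[OF endoU subU]
        by (simp add: E_def)
    next
      fix x y assume xy: "x \<in> E" "y \<in> E"
      then have "f (x + y) - scale c (x + y) = (f x - scale c x) + (f y - scale c y)"
        using endomorphism_onD(2)[OF endoU] by (simp add: E_def scale_right_distrib)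
      then show "x + y \<in> E" using xy subspace_add[OF subU] subspace_add[OF W(1)]
        by (simp add: E_def)
    next
      fix a x assume x: "x \<in> E"
      then have "f (scale a x) - scale c (scale a x) = scale a (f x - scale c x)"
        using endomorphism_onD(3)[OF endoU]
        by (simp add: E_def scale_right_diff_distrib scale_left_commute)
      then show "scale a x \<in> E" using x subspace_scale[OF subU] subspace_scale[OF W(1)]
        by (simp add: E_def)
    qed
    moreover have "W \<subset> E"
    proof -
      have "W \<subseteq> E" using W f U subspace_diff[OF W(1)] subspace_scale[OF W(1)]
        by (auto simp: E_def P_def)
      moreover have "v \<in> E" using v by (simp add: E_def)
      ultimately show ?thesis using v by blast
    qed
    moreover have "g u \<in> E" if g: "g \<in> F" and u: "u \<in> E" for g u
    proof -
      have uN: "u \<in> N" "g u \<in> U" using u g U by (auto simp: E_def P_def)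
      have "f (g u) - scale c (g u) = g (f u - scale c u)"
        using comm[OF f g uN(1)] endomorphism_onD(3)[OF endo[OF g] uN(1)]
          endomorphism_on_diff[OF endo[OF g] N, of "f u" "scale c u"] uN(1)
          endomorphism_onD(1)[OF endo[OF f] uN(1)] subspace_scale[OF N] by simp
      then show ?thesis using u g uN W(3) by (simp add: E_def)
    qed
    ultimately have "P E" using U EU by (auto simp: P_def)
    then have "\<not> E \<subset> U" using least[of E] dim_psubset_of_finite[OF \<open>subspace E\<close> _ fin(1), of U] U fin(2)
      by (force simp: P_def)
    then have "E = U" using EU by blast
    then show ?thesis unfolding E_def by blast
  qed
  moreover obtain v where "v \<in> U" "v \<notin> W" "v \<in> N" using U by (auto simp: P_def)
  ultimately show ?thesis by blast
qed

section \<open>Triangular form of commuting endomorphisms\<close>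

lemma endomorphism_on_span_image:
  assumes f: "endomorphism_on N f" and N: "subspace N" and S: "S \<subseteq> N"
    and T: "subspace T" and img: "\<And>s. s \<in> S \<Longrightarrow> f s \<in> T" and x: "x \<in> span S"
  shows "f x \<in> T"
proof -
  have "subspace {x \<in> N. f x \<in> T}"
    using endomorphism_onD(2,3)[OF f] endomorphism_on_zero[OF f N] N T
    by (intro subspaceI) (auto simp: subspace_0 subspace_add subspace_scale)
  then have "span S \<subseteq> {x \<in> N. f x \<in> T}" using S img by (intro span_minimal) auto
  then show ?thesis using x by blast
qed

text \<open>The first condition expresses linear independence in the form in which the basis is built:
  every vector leaves the span of its predecessors.\<close>

definition flag_basis :: "'b set \<Rightarrow> nat \<Rightarrow> (nat \<Rightarrow> 'b) \<Rightarrow> bool" where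
  "flag_basis N n v \<longleftrightarrow> (\<forall>i<n. v i \<notin> span (v ` {..<i})) \<and> span (v ` {..<n}) = N"

definition triangular_wrt :: "(nat \<Rightarrow> 'b) \<Rightarrow> nat \<Rightarrow> ('b \<Rightarrow> 'b) \<Rightarrow> (nat \<Rightarrow> complex) \<Rightarrow> bool" where
  "triangular_wrt v n f c \<longleftrightarrow> (\<forall>i<n. f (v i) - scale (c i) (v i) \<in> span (v ` {..<i}))"

lemma independent_of_flag:
  assumes "\<And>i. i < n \<Longrightarrow> v i \<notin> span (v ` {..<i})"
  shows "independent (v ` {..<n})" "card (v ` {..<n}) = n"
proof -
  have "independent (v ` {..<n}) \<and> card (v ` {..<n}) = n" using assms
  proof (induction n)
    case (Suc n)
    have "v n \<notin> v ` {..<n}" using Suc.prems[of n] span_base by (metis lessI)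
    then show ?case using Suc by (simp add: lessThan_Suc independent_insertI)
  qed (simp add: independent_empty)
  then show "independent (v ` {..<n})" "card (v ` {..<n}) = n" by auto
qed

lemma span_lessThan_mono: "i \<le> j \<Longrightarrow> span (v ` {..<i}) \<subseteq> span (v ` {..<j :: nat})"
  by (intro span_mono image_mono) auto

lemma in_span_lessThan: "i < j \<Longrightarrow> v i \<in> span (v ` {..<j :: nat})"
  by (intro span_base) auto

text \<open>A unitriangular change of basis inverts along the flag.\<close>

lemma flag_in_span_of_leading:
  fixes e v :: "nat \<Rightarrow> 'b"
  assumes "\<And>i. i < n \<Longrightarrow> e i - v i \<in> span (v ` {..<i})" "m \<le> n"
  shows "span (v ` {..<m}) \<subseteq> span (e ` {..<m})"
  using assms(2)
proof (induction m)
  case (Suc m)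
  have sub: "span (e ` {..<m}) \<subseteq> span (e ` {..<Suc m})" by (intro span_lessThan_mono) simp
  have "e m - v m \<in> span (e ` {..<Suc m})" using Suc assms(1)[of m] sub by auto
  then have "v m \<in> span (e ` {..<Suc m})"
    using span_diff[OF in_span_lessThan[of m "Suc m" e]] by fastforce
  then have "v ` {..<Suc m} \<subseteq> span (e ` {..<Suc m})"
    using Suc sub span_superset[of "v ` {..<m}"] by (auto simp: lessThan_Suc)
  then show ?case by (intro span_minimal) auto
qed simp

lemma triangular_step:
  assumes "triangular_wrt v n f c" "i < n"
  shows "f (v i) \<in> span (v ` {..<Suc i})"
proof -
  have "f (v i) - scale (c i) (v i) \<in> span (v ` {..<Suc i})"
    using assms span_lessThan_mono[of i "Suc i" v] by (auto simp: triangular_wrt_def)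
  moreover have "scale (c i) (v i) \<in> span (v ` {..<Suc i})"
    by (intro span_scale in_span_lessThan) simp
  ultimately show ?thesis using span_add by fastforce
qed

lemma triangular_invariant:
  assumes tri: "triangular_wrt v n f c" and f: "endomorphism_on N f" and N: "subspace N"
    and vN: "\<And>i. i < n \<Longrightarrow> v i \<in> N" and m: "m \<le> n" and u: "u \<in> span (v ` {..<m})"
  shows "f u \<in> span (v ` {..<m})"
proof (rule endomorphism_on_span_image[OF f N _ subspace_span _ u])
  show "v ` {..<m} \<subseteq> N" using vN m by auto
  fix s assume "s \<in> v ` {..<m}"
  then obtain i where i: "i < m" "s = v i" by auto
  then show "f s \<in> span (v ` {..<m})"
    using triangular_step[OF tri, of i] span_lessThan_mono[of "Suc i" m v] m by auto
qed

text \<open>For \<open>m = 0\<close> the truncated subtraction is harmless, as both spans are then zero.\<close>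

lemma triangular_zero_diagonal_shift:
  assumes tri: "triangular_wrt v n f c" and f: "endomorphism_on N f" and N: "subspace N"
    and vN: "\<And>i. i < n \<Longrightarrow> v i \<in> N" and m: "m \<le> n" and c: "\<And>i. i < m \<Longrightarrow> c i = 0"
    and u: "u \<in> span (v ` {..<m})"
  shows "f u \<in> span (v ` {..<m - 1})"
proof (rule endomorphism_on_span_image[OF f N _ subspace_span _ u])
  show "v ` {..<m} \<subseteq> N" using vN m by auto
  fix s assume "s \<in> v ` {..<m}"
  then obtain i where i: "i < m" "s = v i" by auto
  have "f (v i) - scale (c i) (v i) \<in> span (v ` {..<i})"
    using tri m i(1) by (auto simp: triangular_wrt_def)
  then have "f s \<in> span (v ` {..<i})" using c[OF i(1)] i(2) by simp
  moreover have "i \<le> m - 1" using i(1) by simp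
  ultimately show "f s \<in> span (v ` {..<m - 1})" using span_lessThan_mono by blast
qed

lemma triangular_zero_diagonal_funpow:
  assumes tri: "triangular_wrt v n f c" and f: "endomorphism_on N f" and N: "subspace N"
    and vN: "\<And>i. i < n \<Longrightarrow> v i \<in> N" and m: "m \<le> n" and c: "\<And>i. i < m \<Longrightarrow> c i = 0"
    and u: "u \<in> span (v ` {..<m})"
  shows "(f ^^ m) u = 0"
proof -
  have "(f ^^ j) u \<in> span (v ` {..<m - j})" for j
  proof (induction j)
    case (Suc j)
    have "f ((f ^^ j) u) \<in> span (v ` {..<m - j - 1})"
      using m c Suc by (intro triangular_zero_diagonal_shift[OF tri f N vN]) auto
    then show ?case by simp
  qed (use u in simp)
  from this[of m] show ?thesis by simp
qed

lemma nilpotent_imp_zero_diagonal: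
  assumes flag: "flag_basis N n v" and tri: "triangular_wrt v n f c"
    and f: "endomorphism_on N f" and nil: "\<And>u. u \<in> N \<Longrightarrow> (f ^^ m) u = 0" and i: "i < n"
  shows "c i = 0"
proof (rule ccontr)
  assume ci: "c i \<noteq> 0"
  have N: "subspace N" using flag by (auto simp: flag_basis_def)
  have vN: "v j \<in> N" if "j < n" for j
    using flag in_span_lessThan[OF that, of v] by (simp add: flag_basis_def)
  let ?W = "span (v ` {..<i})"
  have "(f ^^ j) (v i) - scale (c i ^ j) (v i) \<in> ?W" for j
  proof (induction j)
    case 0
    then show ?case by (simp add: span_zero)
  next
    case (Suc j)
    let ?w = "(f ^^ j) (v i) - scale (c i ^ j) (v i)"
    have mem: "(f ^^ j) (v i) \<in> N" "scale (c i ^ j) (v i) \<in> N"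
      using endomorphism_onD(1)[OF endomorphism_on_funpow[OF f] vN[OF i]] vN[OF i] N subspace_scale by auto
    have "f ?w \<in> ?W" using triangular_invariant[OF tri f N vN _ Suc] i by simp
    moreover have "f ?w = f ((f ^^ j) (v i)) - scale (c i ^ j) (f (v i))"
      using endomorphism_on_diff[OF f N mem] endomorphism_onD(3)[OF f vN[OF i]] by simp
    moreover have "scale (c i ^ j) (f (v i) - scale (c i) (v i)) \<in> ?W"
      using tri i by (intro span_scale) (auto simp: triangular_wrt_def)
    ultimately have "f ((f ^^ j) (v i)) - scale (c i ^ j) (f (v i)) +
        scale (c i ^ j) (f (v i) - scale (c i) (v i)) \<in> ?W"
      using span_add by metis
    then show ?case by (simp add: scale_right_diff_distrib mult.commute)
  qed
  from this[of m] have "- scale (c i ^ m) (v i) \<in> ?W" using nil vN[OF i] by simp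
  then have "scale (inverse (c i ^ m)) (scale (c i ^ m) (v i)) \<in> ?W"
    using span_neg span_scale by fastforce
  then have "v i \<in> ?W" using ci by simp
  then show False using flag i by (simp add: flag_basis_def)
qed

text \<open>The flag is built from below: its span so far is invariant, and a common eigenvector modulo this
  span is the next basis vector.\<close>

lemma ex_common_triangular_basis:
  assumes N: "subspace N" and fin: "finite B" "N \<subseteq> span B"
    and endo: "\<And>f. f \<in> F \<Longrightarrow> endomorphism_on N f"
    and comm: "\<And>f g v. f \<in> F \<Longrightarrow> g \<in> F \<Longrightarrow> v \<in> N \<Longrightarrow> f (g v) = g (f v)"
  obtains v where "flag_basis N (dim N) v" "\<And>f. f \<in> F \<Longrightarrow> \<exists>c. triangular_wrt v (dim N) f c"
proof -
  have "\<exists>v. \<forall>i<m. v i \<in> N \<and> v i \<notin> span (v ` {..<i}) \<and>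
      (\<forall>f\<in>F. \<exists>c. f (v i) - scale c (v i) \<in> span (v ` {..<i}))" if "m \<le> dim N" for m
    using that
  proof (induction m)
    case (Suc m)
    then obtain v where v: "\<And>i. i < m \<Longrightarrow> v i \<in> N" "\<And>i. i < m \<Longrightarrow> v i \<notin> span (v ` {..<i})"
      "\<And>i f. i < m \<Longrightarrow> f \<in> F \<Longrightarrow> \<exists>c. f (v i) - scale c (v i) \<in> span (v ` {..<i})" by force
    define W where "W = span (v ` {..<m})"
    have "W \<subseteq> N" unfolding W_def using v(1) N by (intro span_minimal) auto
    moreover have "dim W = m"
      unfolding W_def using independent_of_flag[of m v] v(2) dim_span_eq_card_independent by metis
    ultimately have WN: "W \<subset> N" using Suc.prems by auto
    have inv: "f x \<in> W" if f: "f \<in> F" and x: "x \<in> W" for f x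
    proof -
      obtain c where "triangular_wrt v m f c"
        unfolding triangular_wrt_def using v(3)[OF _ f] by metis
      from triangular_invariant[OF this endo[OF f] N v(1) order_refl] show ?thesis
        using x unfolding W_def by blast
    qed
    have "subspace W" by (simp add: W_def)
    have "\<exists>u\<in>N. u \<notin> W \<and> (\<forall>f\<in>F. \<exists>c. f u - scale c u \<in> W)"
      by (rule ex_common_relative_eigenvector[OF N fin])
        (fact endo comm \<open>subspace W\<close> WN inv)+
    then obtain u where u: "u \<in> N" "u \<notin> W" "\<And>f. f \<in> F \<Longrightarrow> \<exists>c. f u - scale c u \<in> W" by blast
    have img: "(v(m := u)) ` {..<i} = v ` {..<i}" if "i \<le> m" for i using that by auto
    have "\<forall>i<Suc m. (v(m := u)) i \<in> N \<and> (v(m := u)) i \<notin> span ((v(m := u)) ` {..<i}) \<and>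
      (\<forall>f\<in>F. \<exists>c. f ((v(m := u)) i) - scale c ((v(m := u)) i) \<in> span ((v(m := u)) ` {..<i}))"
    proof (intro allI impI)
      fix i assume "i < Suc m"
      then have i: "i \<le> m" by simp
      show "(v(m := u)) i \<in> N \<and> (v(m := u)) i \<notin> span ((v(m := u)) ` {..<i}) \<and>
        (\<forall>f\<in>F. \<exists>c. f ((v(m := u)) i) - scale c ((v(m := u)) i) \<in> span ((v(m := u)) ` {..<i}))"
        unfolding img[OF i] using i u v[of i] by (cases "i = m") (auto simp: W_def)
    qed
    then show ?case by blast
  qed simp
  from this[OF order_refl] obtain v where v: "\<And>i. i < dim N \<Longrightarrow> v i \<in> N"
    "\<And>i. i < dim N \<Longrightarrow> v i \<notin> span (v ` {..<i})"
    "\<And>i f. i < dim N \<Longrightarrow> f \<in> F \<Longrightarrow> \<exists>c. f (v i) - scale c (v i) \<in> span (v ` {..<i})" by blast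
  have "span (v ` {..<dim N}) \<subseteq> N" using v(1) N by (intro span_minimal) auto
  moreover have "dim (span (v ` {..<dim N})) = dim N"
    using independent_of_flag[of "dim N" v] v(2) dim_span_eq_card_independent by metis
  ultimately have "span (v ` {..<dim N}) = N"
    using dim_psubset_of_finite[OF subspace_span _ fin, of "v ` {..<dim N}"] by auto
  then have "flag_basis N (dim N) v" using v(2) by (simp add: flag_basis_def)
  moreover have "\<exists>c. triangular_wrt v (dim N) f c" if "f \<in> F" for f
    unfolding triangular_wrt_def using v(3)[OF _ that] by metis
  ultimately show thesis using that by blast
qed

section \<open>Jacobson's lemma on commutators\<close>

text \<open>If \<open>Z = B A - A B\<close> commutes with \<open>A\<close>, then \<open>Z\<close> is nilpotent. Taking the commutator with \<open>B\<close> acts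
  on polynomials in \<open>A\<close> as differentiation and multiplication by \<open>Z\<close>. A polynomial annihilating \<open>A\<close> can thus be
  differentiated down to a nonzero constant at the price of powers of \<open>Z\<close>; characteristic zero
  keeps the derivatives from vanishing too early.\<close>

context
  fixes N A B Z
  assumes N: "subspace N" and A: "endomorphism_on N A" and B: "endomorphism_on N B"
    and Z: "\<And>v. v \<in> N \<Longrightarrow> Z v = B (A v) - A (B v)"
    and ZA: "\<And>v. v \<in> N \<Longrightarrow> Z (A v) = A (Z v)"
begin

lemma endomorphism_on_commutator: "endomorphism_on N Z"
  unfolding endomorphism_on_def
  using Z endomorphism_onD[OF A] endomorphism_onD[OF B] subspace_diff[OF N] subspace_add[OF N]
    subspace_scale[OF N]
  by (simp add: scale_right_diff_distrib)

lemma commutator_poly_apply: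
  assumes v: "v \<in> N"
  shows "B (poly_apply A p v) - poly_apply A p (B v) = poly_apply A (pderiv p) (Z v)"
proof (induction p)
  case 0
  then show ?case using endomorphism_on_zero[OF B N] by simp
next
  case (pCons a q)
  note step = poly_apply_step[OF N A] and closed = poly_apply_closed[OF N A]
  let ?w = "poly_apply A q v"
  have w: "?w \<in> N" using closed[OF v] .
  have mem: "A ?w \<in> N" "B ?w \<in> N" "scale a v \<in> N" "B v \<in> N" "Z v \<in> N"
    "poly_apply A q (B v) \<in> N"
    using w v closed endomorphism_onD(1)[OF A] endomorphism_onD(1)[OF B] subspace_scale[OF N]
      endomorphism_onD(1)[OF endomorphism_on_commutator] by auto
  have "B (poly_apply A (pCons a q) v) - poly_apply A (pCons a q) (B v) =
      B (A ?w) - A (poly_apply A q (B v))"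
    using endomorphism_onD(2)[OF B mem(3,1)] endomorphism_onD(3)[OF B v] by (simp add: step)
  also have "\<dots> = Z ?w + A (B ?w - poly_apply A q (B v))"
    using Z[OF w] endomorphism_on_diff[OF A N mem(2,6)] by simp
  also have "\<dots> = Z ?w + A (poly_apply A (pderiv q) (Z v))" by (simp add: pCons)
  also have "Z ?w = poly_apply A q (Z v)"
    using poly_apply_commute[OF N A endomorphism_on_commutator ZA[symmetric] v] by simp
  also have "poly_apply A q (Z v) + A (poly_apply A (pderiv q) (Z v)) =
      poly_apply A (pderiv (pCons a q)) (Z v)"
    using poly_apply_add[OF N A mem(5)] by (simp add: pderiv_pCons step)
  finally show ?case .
qed

text \<open>If \<open>p(A) Z^m = 0\<close>, then \<open>p'(A) Z^(2 m + 1) = 0\<close>: in \<open>p'(A) Z Z^m = B p(A) Z^m - p(A) B Z^m\<close> the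
  first term vanishes, and multiplying the second by \<open>Z^m\<close>, which commutes with \<open>p(A)\<close>, kills it
  too. Induction on the degree of \<open>p\<close> ends with a constant.\<close>

lemma commutator_nilpotent_of_annihilated:
  assumes "p \<noteq> 0" "\<And>v. v \<in> N \<Longrightarrow> poly_apply A p ((Z ^^ m) v) = 0"
  shows "\<exists>m. \<forall>v\<in>N. (Z ^^ m) v = 0"
  using assms
proof (induction "degree p" arbitrary: p m)
  case 0
  then obtain c where c: "p = [:c:]" using degree_eq_zeroE by metis
  then have "c \<noteq> 0" using 0 by simp
  then have "(Z ^^ m) v = 0" if "v \<in> N" for v
    using 0(3)[OF that] poly_apply_const[OF N A, of c] by (simp add: c)
  then show ?case by blast
next
  case (Suc d)
  note Zpow = endomorphism_on_funpow[OF endomorphism_on_commutator]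
  have "poly_apply A (pderiv p) ((Z ^^ (m + Suc m)) v) = 0" if v: "v \<in> N" for v
  proof -
    let ?u = "(Z ^^ m) v"
    have u: "?u \<in> N" "B ?u \<in> N" "Z ?u \<in> N" "poly_apply A p (B ?u) \<in> N"
      using endomorphism_onD(1)[OF Zpow v] endomorphism_onD(1)[OF B]
        endomorphism_onD(1)[OF endomorphism_on_commutator] poly_apply_closed[OF N A] by auto
    have comm: "A ((Z ^^ m) w) = (Z ^^ m) (A w)" if "w \<in> N" for w
    proof (induction m)
      case (Suc m)
      have "A (Z ((Z ^^ m) w)) = Z (A ((Z ^^ m) w))"
        using ZA[OF endomorphism_onD(1)[OF Zpow that]] by simp
      then show ?case using Suc by simp
    qed simp
    have "(Z ^^ m) (poly_apply A (pderiv p) (Z ?u)) = (Z ^^ m) (0 - poly_apply A p (B ?u))"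
      using commutator_poly_apply[OF u(1), of p] Suc.prems(2)[OF v] endomorphism_on_zero[OF B N]
      by simp
    also have "\<dots> = 0 - poly_apply A p ((Z ^^ m) (B ?u))"
      using poly_apply_commute[OF N A Zpow comm u(2)] endomorphism_on_zero[OF Zpow N]
        endomorphism_on_diff[OF Zpow N subspace_0[OF N] u(4), of m] by simp
    also have "\<dots> = 0" using Suc.prems(2)[OF u(2)] by simp
    finally have "poly_apply A (pderiv p) ((Z ^^ m) (Z ?u)) = 0"
      using poly_apply_commute[OF N A Zpow comm u(3)] by simp
    then show ?thesis by (simp add: funpow_add funpow_swap1)
  qed
  moreover have "d = degree (pderiv p)" using Suc.hyps(2) by (simp add: degree_pderiv)
  moreover have "pderiv p \<noteq> 0" using Suc.hyps(2) by (simp add: pderiv_eq_0_iff)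
  ultimately show ?case using Suc.hyps(1) by blast
qed

lemma commutator_nilpotent:
  assumes "finite C" "N = span C"
  shows "\<exists>m. \<forall>v\<in>N. (Z ^^ m) v = 0"
proof -
  obtain p where "p \<noteq> 0" "\<forall>v\<in>N. poly_apply A p v = 0"
    using ex_annihilating_poly[OF N A assms] by blast
  then show ?thesis using commutator_nilpotent_of_annihilated[of p 0] by simp
qed

end

section \<open>Multiplications and ideals\<close>

lemma bracket_span_sub:
  assumes "subspace T" "\<And>x y. x \<in> A \<Longrightarrow> y \<in> B \<Longrightarrow> br x y \<in> T"
  shows "bracket_span br A B \<subseteq> T"
  unfolding bracket_span_def using assms by (intro span_minimal) auto

lemma bracket_in_bracket_span: "x \<in> A \<Longrightarrow> y \<in> B \<Longrightarrow> br x y \<in> bracket_span br A B"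
  unfolding bracket_span_def by (intro span_base) blast

end

sublocale leibniz_algebra \<subseteq> complex_vector_space scale
  by unfold_locales

context leibniz_algebra
begin

lemma subspace_L: "subspace L"
  using finite_dimensional by auto

lemma right_multiplication: "y \<in> L \<Longrightarrow> endomorphism_on L (\<lambda>x. br x y)"
  unfolding endomorphism_on_def
  using bracket_closed bracket_add_left bracket_scale_left by simp

lemma left_multiplication: "x \<in> L \<Longrightarrow> endomorphism_on L (br x)"
  unfolding endomorphism_on_def
  using bracket_closed bracket_add_right bracket_scale_right by simp

lemmas bracket_diff_left = endomorphism_on_diff[OF right_multiplication subspace_L]
lemmas bracket_zero_left = endomorphism_on_zero[OF right_multiplication subspace_L]
lemmas bracket_zero_right = endomorphism_on_zero[OF left_multiplication subspace_L]

text \<open>The form of the Leibniz identity that is used most: right multiplications are derivations.\<close>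

lemma right_multiplication_derivation:
  assumes "x \<in> L" "y \<in> L" "z \<in> L"
  shows "br (br x y) z = br (br x z) y + br x (br y z)"
  using leibniz_identity[OF assms] by simp

lemma bracket_sum_left:
  assumes "\<And>i. i \<in> I \<Longrightarrow> f i \<in> L" "z \<in> L"
  shows "br (\<Sum>i\<in>I. f i) z = (\<Sum>i\<in>I. br (f i) z)"
  using assms
proof (induction I rule: infinite_finite_induct)
  case (insert i I)
  then show ?case
    using bracket_add_left[of "f i" "sum f I" z] subspace_sum[OF subspace_L, of I f] by simp
qed (simp_all add: bracket_zero_left)

lemma bracket_sum_right:
  assumes "\<And>i. i \<in> I \<Longrightarrow> f i \<in> L" "z \<in> L"
  shows "br z (\<Sum>i\<in>I. f i) = (\<Sum>i\<in>I. br z (f i))"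
  using assms
proof (induction I rule: infinite_finite_induct)
  case (insert i I)
  then show ?case
    using bracket_add_right[of z "f i" "sum f I"] subspace_sum[OF subspace_L, of I f] by simp
qed (simp_all add: bracket_zero_right)

lemma leibniz_subalgebra:
  assumes "finite B" "span B = S" and SL: "S \<subseteq> L"
    and closed: "\<And>u w. u \<in> S \<Longrightarrow> w \<in> S \<Longrightarrow> br u w \<in> S"
  shows "leibniz_algebra scale br S"
proof (intro leibniz_algebra.intro leibniz_algebra_axioms.intro)
  show "vector_space scale" by (rule vector_space_axioms)
  show "\<exists>B. finite B \<and> span B = S" using assms(1,2) by blast
  show "br u w \<in> S" if "u \<in> S" "w \<in> S" for u w using closed that .
  fix u v w c assume u: "u \<in> S" and v: "v \<in> S"
  then have L: "u \<in> L" "v \<in> L" using SL by auto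
  show "br (scale c u) v = scale c (br u v)" using bracket_scale_left[OF L] .
  show "br u (scale c v) = scale c (br u v)" using bracket_scale_right[OF L] .
  assume "w \<in> S"
  then have w: "w \<in> L" using SL by auto
  show "br (u + v) w = br u w + br v w" using bracket_add_left[OF L w] .
  show "br u (v + w) = br u v + br u w" using bracket_add_right[OF L w] .
  show "br u (br v w) = br (br u v) w - br (br u w) v" using leibniz_identity[OF L w] .
qed

lemma bracket_spans_in_subspace:
  assumes A: "A \<subseteq> L" and B: "B \<subseteq> L" and T: "subspace T"
    and img: "\<And>a b. a \<in> A \<Longrightarrow> b \<in> B \<Longrightarrow> br a b \<in> T"
    and u: "u \<in> span A" and w: "w \<in> span B"
  shows "br u w \<in> T"
proof -
  have "u \<in> L" using u A span_minimal subspace_L by blast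
  show ?thesis
  proof (rule endomorphism_on_span_image[OF left_multiplication[OF \<open>u \<in> L\<close>] subspace_L B T _ w])
    fix b assume b: "b \<in> B"
    then have "b \<in> L" using B by blast
    show "br u b \<in> T"
      using endomorphism_on_span_image[OF right_multiplication[OF \<open>b \<in> L\<close>] subspace_L A T _ u] img b
      by blast
  qed
qed

lemma ideal_bracket_span:
  assumes D: "ideal_of br L D"
  shows "ideal_of br L (bracket_span br D D)"
  unfolding ideal_of_def
proof (intro conjI ballI)
  let ?G = "{br x y |x y. x \<in> D \<and> y \<in> D}" and ?S = "bracket_span br D D"
  have DL: "D \<subseteq> L" and cl: "\<And>x y. x \<in> D \<Longrightarrow> y \<in> L \<Longrightarrow> br x y \<in> D" "\<And>x y. x \<in> D \<Longrightarrow> y \<in> L \<Longrightarrow> br y x \<in> D"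
    using D by (auto simp: ideal_of_def)
  show sub: "subspace ?S" by (simp add: bracket_span_def)
  have brL: "br x y \<in> L" if "x \<in> D" "y \<in> D" for x y
    using that DL bracket_closed[of x y] by auto
  then show "?S \<subseteq> L" by (rule bracket_span_sub[OF subspace_L])
  have GL: "?G \<subseteq> L" using brL by auto
  fix u y assume u: "u \<in> ?S" and y: "y \<in> L"
  note u' = u[unfolded bracket_span_def]
  show "br u y \<in> ?S"
  proof (rule endomorphism_on_span_image[OF right_multiplication[OF y] subspace_L GL sub _ u'])
    fix s assume "s \<in> ?G"
    then obtain a b where ab: "a \<in> D" "b \<in> D" "s = br a b" by blast
    have "br s y = br (br a y) b + br a (br b y)"
      using right_multiplication_derivation[of a b y] ab y DL by auto
    then show "br s y \<in> ?S"
      using ab y cl bracket_in_bracket_span subspace_add[OF sub] by auto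
  qed
  show "br y u \<in> ?S"
  proof (rule endomorphism_on_span_image[OF left_multiplication[OF y] subspace_L GL sub _ u'])
    fix s assume "s \<in> ?G"
    then obtain a b where ab: "a \<in> D" "b \<in> D" "s = br a b" by blast
    have "br y s = br (br y a) b - br (br y b) a"
      using leibniz_identity[of y a b] ab y DL by auto
    then show "br y s \<in> ?S"
      using ab y cl bracket_in_bracket_span subspace_diff[OF sub] by auto
  qed
qed

lemma ideal_derived: "ideal_of br L (derived br L j)"
proof (induction j)
  case 0
  then show ?case using subspace_L bracket_closed by (simp add: ideal_of_def)
qed (simp add: ideal_bracket_span)

end

section \<open>The derived algebra lies in the nilradical\<close>

locale abelian_nilradical = leibniz_algebra scale br R
  for scale :: "complex \<Rightarrow> 'a::ab_group_add \<Rightarrow> 'a" and br R +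
  fixes N :: "'a set" and k :: nat
  assumes solvable_R: "complex_vector_space.solvable scale br R"
    and nilradical_N: "complex_vector_space.is_nilradical scale br R N"
    and abelian_N: "complex_vector_space.is_abelian_algebra scale k br N"
begin

lemma subspace_N: "subspace N" and N_sub: "N \<subseteq> R" and dim_N: "dim N = k"
  and N_right: "n \<in> N \<Longrightarrow> x \<in> R \<Longrightarrow> br n x \<in> N"
  and N_left: "n \<in> N \<Longrightarrow> x \<in> R \<Longrightarrow> br x n \<in> N"
  and bracket_N: "n \<in> N \<Longrightarrow> m \<in> N \<Longrightarrow> br n m = 0"
  using nilradical_N abelian_N
  by (auto simp: is_nilradical_def ideal_of_def is_abelian_algebra_def)

lemma nilpotent_ideal_sub: "ideal_of br R J \<Longrightarrow> nilpotent br J \<Longrightarrow> J \<subseteq> N"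
  using nilradical_N by (simp add: is_nilradical_def)

lemma N_sub_span: obtains B where "finite B" "N \<subseteq> span B"
  using finite_dimensional N_sub by auto

lemma N_basis: obtains C where "finite C" "N = span C" "card C = k"
proof -
  obtain B where B: "finite B" "N \<subseteq> span B" by (rule N_sub_span)
  obtain C where C: "C \<subseteq> N" "independent C" "N \<subseteq> span C" "card C = dim N"
    using basis_exists by blast
  have "finite C" using independent_span_bound[OF B(1) C(2)] C(1) B(2) by blast
  moreover have "N = span C" using C(1,3) span_minimal subspace_N by blast
  ultimately show thesis using that C(4) dim_N by simp
qed

lemma endomorphism_N: "x \<in> R \<Longrightarrow> endomorphism_on N (\<lambda>n. br n x)"
  using endomorphism_on_subset[OF right_multiplication N_sub] N_right by blast

text \<open>The commutator of the two actions is the action of \<open>[x, y]\<close>, which is zero since \<open>N\<close> is abelian.\<close>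

lemma right_multiplications_commute:
  assumes "n \<in> N" "x \<in> R" "y \<in> R" "br x y \<in> N"
  shows "br (br n x) y = br (br n y) x"
  using leibniz_identity[of n x y] bracket_N[OF assms(1,4)] assms N_sub by auto

lemma common_flag:
  assumes J: "J \<subseteq> R" "\<And>x y. x \<in> J \<Longrightarrow> y \<in> J \<Longrightarrow> br x y \<in> N"
  obtains v c where "flag_basis N k v" "\<And>x. x \<in> J \<Longrightarrow> triangular_wrt v k (\<lambda>n. br n x) (c x)"
proof -
  obtain B where B: "finite B" "N \<subseteq> span B" by (rule N_sub_span)
  let ?F = "(\<lambda>x n. br n x) ` J"
  have endo: "endomorphism_on N f" if "f \<in> ?F" for f
    using that endomorphism_N J(1) by blast
  have comm: "f (g v) = g (f v)" if "f \<in> ?F" "g \<in> ?F" "v \<in> N" for f g v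
    using that right_multiplications_commute J by blast
  obtain v where v: "flag_basis N (dim N) v" "\<And>f. f \<in> ?F \<Longrightarrow> \<exists>c. triangular_wrt v (dim N) f c"
    using ex_common_triangular_basis[OF subspace_N B, of ?F] endo comm by metis
  then have "\<forall>x\<in>J. \<exists>c. triangular_wrt v k (\<lambda>n. br n x) c" by (simp add: dim_N)
  then obtain c where "\<forall>x\<in>J. triangular_wrt v k (\<lambda>n. br n x) (c x)" by (rule bchoice[THEN exE])
  then show thesis using that[of v c] v(1) dim_N by simp
qed

lemma flag_in_N:
  assumes "flag_basis N k v" "i < k"
  shows "v i \<in> N"
  using assms in_span_lessThan[of i k v] by (simp add: flag_basis_def)

text \<open>In a basis that makes the commuting actions of \<open>J\<close> triangular, the generators have zero
  diagonal, because they act nilpotently. Zero diagonal is a linear condition, so all of \<open>J\<close> moves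
  each flag member into the preceding one. As \<open>[J, J]\<close> starts inside \<open>N\<close>, the lower central series
  reaches zero after \<open>k\<close> further steps, and maximality of the nilradical applies.\<close>

lemma ideal_sub_nilradical:
  assumes J: "ideal_of br R J" "J = span G" and JJ: "\<And>x y. x \<in> J \<Longrightarrow> y \<in> J \<Longrightarrow> br x y \<in> N"
    and nil: "\<And>g. g \<in> G \<Longrightarrow> \<exists>m. \<forall>n\<in>N. ((\<lambda>n. br n g) ^^ m) n = 0"
  shows "J \<subseteq> N"
proof (rule nilpotent_ideal_sub[OF J(1)])
  have JR: "J \<subseteq> R" using J(1) by (simp add: ideal_of_def)
  have GJ: "G \<subseteq> J" using J(2) span_superset by blast
  obtain v c where flag: "flag_basis N k v"
    and tri: "\<And>x. x \<in> J \<Longrightarrow> triangular_wrt v k (\<lambda>n. br n x) (c x)"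
    using common_flag[OF JR JJ] by metis
  note vN = flag_in_N[OF flag]
  have zero: "triangular_wrt v k (\<lambda>n. br n x) (\<lambda>_. 0)" if x: "x \<in> J" for x
    unfolding triangular_wrt_def
  proof (intro allI impI)
    fix i assume i: "i < k"
    have "br (v i) x \<in> span (v ` {..<i})"
    proof (rule endomorphism_on_span_image[OF left_multiplication subspace_L _ subspace_span])
      show "v i \<in> R" "G \<subseteq> R" "x \<in> span G" using vN[OF i] N_sub GJ JR x J(2) by auto
      fix g assume g: "g \<in> G"
      then have gJ: "g \<in> J" using GJ by blast
      obtain m where m: "\<And>n. n \<in> N \<Longrightarrow> ((\<lambda>n. br n g) ^^ m) n = 0" using nil[OF g] by blast
      have "c g i = 0"
        using nilpotent_imp_zero_diagonal[OF flag tri[OF gJ] endomorphism_N m i] gJ JR by blast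
      then show "br (v i) g \<in> span (v ` {..<i})"
        using tri[OF gJ] i unfolding triangular_wrt_def by force
    qed
    then show "br (v i) x - scale 0 (v i) \<in> span (v ` {..<i})" by simp
  qed
  have "lower_central br J (Suc j) \<subseteq> span (v ` {..<k - j})" for j
  proof (induction j)
    case 0
    have "bracket_span br J J \<subseteq> N" using JJ by (rule bracket_span_sub[OF subspace_N])
    then show ?case using flag by (simp add: flag_basis_def)
  next
    case (Suc j)
    have "br u x \<in> span (v ` {..<k - Suc j})" if "u \<in> span (v ` {..<k - j})" "x \<in> J" for u x
    proof -
      have "br u x \<in> span (v ` {..<k - j - 1})"
        using that JR
        by (intro triangular_zero_diagonal_shift[OF zero endomorphism_N subspace_N vN, of x "k - j"])
          auto
      then show ?thesis by simp
    qed
    then have "bracket_span br (lower_central br J (Suc j)) J \<subseteq> span (v ` {..<k - Suc j})"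
      using Suc by (intro bracket_span_sub subspace_span) blast
    then show ?case by simp
  qed
  from this[of k] have "lower_central br J (Suc k) \<subseteq> {0}" by simp
  moreover have "0 \<in> lower_central br J (Suc k)" by (simp add: bracket_span_def span_zero)
  ultimately show "nilpotent br J" unfolding nilpotent_def by blast
qed

text \<open>Jacobson's lemma: the hypothesis makes the actions of \<open>[x, y]\<close> and \<open>x\<close> commute.\<close>

lemma commutator_acts_nilpotently:
  assumes x: "x \<in> R" and y: "y \<in> R" and comm: "br (br x y) x \<in> N"
  shows "\<exists>m. \<forall>n\<in>N. ((\<lambda>n. br n (br x y)) ^^ m) n = 0"
proof -
  obtain C where C: "finite C" "N = span C" using N_basis by metis
  show ?thesis
  proof (rule commutator_nilpotent[OF subspace_N endomorphism_N[OF x] endomorphism_N[OF y] _ _ C])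
    fix n assume n: "n \<in> N"
    then show "br n (br x y) = br (br n x) y - br (br n y) x"
      using leibniz_identity[of n x y] x y N_sub by auto
    show "br (br n x) (br x y) = br (br n (br x y)) x"
      using right_multiplications_commute[OF n bracket_closed[OF x y] x comm] by simp
  qed
qed

text \<open>As \<open>[[d, x], d]\<close> lies in \<open>[D, D]\<close>, Jacobson's lemma makes \<open>[d, x]\<close> act nilpotently, and the
  ideal spanned by all brackets of \<open>D\<close> with \<open>R\<close> satisfies the criterion.\<close>

lemma bracket_in_nilradical_of_abelian_mod_nilradical:
  assumes D: "ideal_of br R D" and DD: "\<And>x y. x \<in> D \<Longrightarrow> y \<in> D \<Longrightarrow> br x y \<in> N"
    and d: "d \<in> D" and x: "x \<in> R"
  shows "br d x \<in> N" "br x d \<in> N"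
proof -
  have DR: "D \<subseteq> R" and subD: "subspace D"
    and cl: "\<And>x y. x \<in> D \<Longrightarrow> y \<in> R \<Longrightarrow> br x y \<in> D" "\<And>x y. x \<in> D \<Longrightarrow> y \<in> R \<Longrightarrow> br y x \<in> D"
    using D by (auto simp: ideal_of_def)
  \<comment> \<open>The symmetric sums replace the brackets \<open>[x, d]\<close> as generators: by the Leibniz identity they
    act as zero from the right, so only the brackets \<open>[d, x]\<close> need Jacobson's lemma.\<close>
  define G where "G = {br d x |d x. d \<in> D \<and> x \<in> R} \<union> {br d x + br x d |d x. d \<in> D \<and> x \<in> R}"
  have GD: "G \<subseteq> D" using cl subspace_add[OF subD] by (auto simp: G_def)
  then have JD: "span G \<subseteq> D" using subD by (rule span_minimal)
  have right: "br d x \<in> span G" if "d \<in> D" "x \<in> R" for d x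
    using that by (intro span_base) (auto simp: G_def)
  have left: "br x d \<in> span G" if "d \<in> D" "x \<in> R" for d x
  proof -
    have "br d x + br x d \<in> span G" using that by (intro span_base) (auto simp: G_def)
    then show ?thesis using span_diff[OF _ right[OF that]] by fastforce
  qed
  have "span G \<subseteq> N"
  proof (rule ideal_sub_nilradical[OF _ refl])
    show "ideal_of br R (span G)"
      unfolding ideal_of_def using JD DR right left by blast
    show "br x y \<in> N" if "x \<in> span G" "y \<in> span G" for x y using that DD JD by blast
    fix g assume "g \<in> G"
    then consider d x where "d \<in> D" "x \<in> R" "g = br d x"
      | d x where "d \<in> D" "x \<in> R" "g = br d x + br x d" by (auto simp: G_def)
    then show "\<exists>m. \<forall>n\<in>N. ((\<lambda>n. br n g) ^^ m) n = 0"
    proof cases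
      case 1
      then show ?thesis using commutator_acts_nilpotently[of d x] DD cl DR by auto
    next
      case 2
      have "br n g = 0" if n: "n \<in> N" for n
        using 2 n N_sub DR leibniz_identity[of n d x] leibniz_identity[of n x d]
          bracket_add_right[of n "br d x" "br x d"] bracket_closed by (auto simp: subset_iff)
      then show ?thesis by (intro exI[of _ 1]) simp
    qed
  qed
  then show "br d x \<in> N" "br x d \<in> N" using right left d x by blast+
qed

text \<open>If the claim failed, the last derived term \<open>D\<close> outside \<open>N\<close> would come after
  \<open>R\<close> in the derived series and thus be spanned by brackets. The previous lemma makes \<open>D\<close> act
  centrally, so these brackets act nilpotently and \<open>D \<subseteq> N\<close> after all.\<close>

theorem derived_in_nilradical:
  assumes "x \<in> R" "y \<in> R"
  shows "br x y \<in> N"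
proof -
  have "derived br R 1 \<subseteq> N"
  proof (rule ccontr)
    assume not1: "\<not> derived br R 1 \<subseteq> N"
    obtain l where l: "derived br R l = {0}" using solvable_R by (auto simp: solvable_def)
    define P where "P j \<longleftrightarrow> derived br R (Suc j) \<subseteq> N" for j
    have "bracket_span br {0} {0} \<subseteq> N"
      using bracket_zero_left[OF subspace_0[OF subspace_L]] subspace_0[OF subspace_N]
      by (intro bracket_span_sub subspace_N) auto
    then have "P l" using l by (simp add: P_def)
    moreover have "\<not> P 0" using not1 by (simp add: P_def)
    moreover have "\<not> P j" if "\<not> P 0" "\<And>j. \<not> P j \<Longrightarrow> \<not> P (Suc j)" for j
      using that by (induction j) auto
    ultimately obtain j where j: "\<not> P j" "P (Suc j)" by blast
    define D where "D = derived br R (Suc j)"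
    have D: "ideal_of br R D" unfolding D_def by (rule ideal_derived)
    have DD: "br x y \<in> N" if "x \<in> D" "y \<in> D" for x y
      using j(2) bracket_in_bracket_span[OF that] by (auto simp: P_def D_def)
    define E where "E = derived br R j"
    have E: "E \<subseteq> R" using ideal_derived[of j] by (auto simp: ideal_of_def E_def)
    have "D \<subseteq> N"
    proof (rule ideal_sub_nilradical[OF D _ DD])
      show "D = span {br x y |x y. x \<in> E \<and> y \<in> E}" by (simp add: D_def E_def bracket_span_def)
      fix g assume "g \<in> {br x y |x y. x \<in> E \<and> y \<in> E}"
      then obtain x y where g: "g = br x y" "x \<in> E" "y \<in> E" by blast
      then have "g \<in> D" using bracket_in_bracket_span by (simp add: D_def E_def)
      then show "\<exists>m. \<forall>n\<in>N. ((\<lambda>n. br n g) ^^ m) n = 0"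
        using commutator_acts_nilpotently[of x y] g E
          bracket_in_nilradical_of_abelian_mod_nilradical(1)[OF D DD] by blast
    qed
    then show False using j(1) by (simp add: P_def D_def)
  qed
  then show ?thesis using bracket_in_bracket_span[OF assms] by auto
qed

section \<open>Weights and the dimension bound\<close>

lemma dim_le_of_kernel_sub:
  assumes "finite I"
    and "\<And>i x y. i \<in> I \<Longrightarrow> x \<in> R \<Longrightarrow> y \<in> R \<Longrightarrow> h i (x + y) = h i x + h i y"
    and "\<And>i x c. i \<in> I \<Longrightarrow> x \<in> R \<Longrightarrow> h i (scale c x) = c * (h i x :: complex)"
    and ker: "\<And>x. x \<in> R \<Longrightarrow> (\<And>i. i \<in> I \<Longrightarrow> h i x = 0) \<Longrightarrow> x \<in> N"
  shows "dim R \<le> card I + k"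
proof -
  obtain Y where Y: "finite Y" "card Y \<le> card I"
    "R \<subseteq> span (Y \<union> {x \<in> R. \<forall>i\<in>I. h i x = 0})"
    using span_common_kernel[of I R h, OF assms(1) subspace_L assms(2,3)] by blast
  obtain C where C: "finite C" "N = span C" "card C = k" using N_basis by metis
  have "Y \<union> {x \<in> R. \<forall>i\<in>I. h i x = 0} \<subseteq> span (Y \<union> C)"
    using ker C(2) span_mono[of C "Y \<union> C"] span_superset[of "Y \<union> C"] by auto
  then have "R \<subseteq> span (Y \<union> C)" using Y(3) span_minimal subspace_span by blast
  then have "dim R \<le> card (Y \<union> C)" using Y(1) C(1) by (intro dim_le_card) auto
  also have "\<dots> \<le> card I + k" using card_Un_le[of Y C] Y(2) C(3) by simp
  finally show ?thesis .
qed

text \<open>A flag of \<open>N\<close> for which all of \<open>R\<close> is triangular; \<open>c x i\<close> is the \<open>i\<close>-th diagonal entry of the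
  action of \<open>x\<close>.\<close>

context
  fixes v :: "nat \<Rightarrow> 'a" and c :: "'a \<Rightarrow> nat \<Rightarrow> complex"
  assumes flag: "flag_basis N k v"
    and tri: "\<And>x. x \<in> R \<Longrightarrow> triangular_wrt v k (\<lambda>n. br n x) (c x)"
begin

lemmas flag_N = flag_in_N[OF flag]

lemma flag_coefficient_zero:
  assumes "i < k" "scale a (v i) \<in> span (v ` {..<i})"
  shows "a = 0"
proof (rule ccontr)
  assume "a \<noteq> 0"
  then have "v i \<in> span (v ` {..<i})" using span_scale[OF assms(2), of "inverse a"] by simp
  then show False using flag assms(1) by (simp add: flag_basis_def)
qed

text \<open>Diagonal entries are determined by the flag; linearity of the weights follows from this.\<close>

lemma weight_eqI:
  assumes "i < k" "x \<in> R" "br (v i) x - scale a (v i) \<in> span (v ` {..<i})"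
  shows "c x i = a"
proof -
  have "br (v i) x - scale (c x i) (v i) \<in> span (v ` {..<i})"
    using tri[OF assms(2)] assms(1) by (simp add: triangular_wrt_def)
  from span_diff[OF assms(3) this] have "scale (c x i - a) (v i) \<in> span (v ` {..<i})"
    by (simp add: scale_left_diff_distrib)
  then show ?thesis using flag_coefficient_zero[OF assms(1)] by fastforce
qed

lemma weight_spec: "i < k \<Longrightarrow> x \<in> R \<Longrightarrow> br (v i) x - scale (c x i) (v i) \<in> span (v ` {..<i})"
  using tri by (simp add: triangular_wrt_def)

lemma weight_add:
  assumes "i < k" "x \<in> R" "y \<in> R"
  shows "c (x + y) i = c x i + c y i"
proof (rule weight_eqI[OF assms(1) subspace_add[OF subspace_L assms(2,3)]])
  have "v i \<in> R" using flag_N assms(1) N_sub by blast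
  then have "br (v i) (x + y) - scale (c x i + c y i) (v i) =
      (br (v i) x - scale (c x i) (v i)) + (br (v i) y - scale (c y i) (v i))"
    using bracket_add_right assms by (simp add: scale_left_distrib)
  then show "br (v i) (x + y) - scale (c x i + c y i) (v i) \<in> span (v ` {..<i})"
    using weight_spec assms span_add by simp
qed

lemma weight_scale:
  assumes "i < k" "x \<in> R"
  shows "c (scale a x) i = a * c x i"
proof (rule weight_eqI[OF assms(1) subspace_scale[OF subspace_L assms(2)]])
  have "v i \<in> R" using flag_N assms(1) N_sub by blast
  then have "br (v i) (scale a x) - scale (a * c x i) (v i) =
      scale a (br (v i) x - scale (c x i) (v i))"
    using bracket_scale_right assms by (simp add: scale_right_diff_distrib)
  then show "br (v i) (scale a x) - scale (a * c x i) (v i) \<in> span (v ` {..<i})"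
    using weight_spec assms span_scale by simp
qed

text \<open>Such an \<open>x\<close> acts by a strictly triangular, hence nilpotent, map, and together with \<open>N\<close> it spans
  an ideal because \<open>[R, R] \<subseteq> N\<close>.\<close>

lemma zero_weights_in_N:
  assumes x: "x \<in> R" and zero: "\<And>i. i < k \<Longrightarrow> c x i = 0"
  shows "x \<in> N"
proof -
  let ?J = "span (insert x N)"
  have JR: "?J \<subseteq> R" using x N_sub subspace_L by (intro span_minimal) auto
  have NJ: "N \<subseteq> ?J" using span_superset by blast
  have "?J \<subseteq> N"
  proof (rule ideal_sub_nilradical[OF _ refl])
    show "ideal_of br R ?J"
      unfolding ideal_of_def using JR NJ derived_in_nilradical by auto
    show "br a b \<in> N" if "a \<in> ?J" "b \<in> ?J" for a b using that JR derived_in_nilradical by auto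
    fix g assume "g \<in> insert x N"
    then show "\<exists>m. \<forall>n\<in>N. ((\<lambda>n. br n g) ^^ m) n = 0"
    proof (elim insertE)
      assume "g = x"
      have "((\<lambda>n. br n x) ^^ k) n = 0" if "n \<in> N" for n
        using that flag
        by (intro triangular_zero_diagonal_funpow[OF tri[OF x] endomorphism_N[OF x] subspace_N
              flag_N order_refl zero]) (simp_all add: flag_basis_def)
      then show ?thesis using \<open>g = x\<close> by blast
    next
      assume "g \<in> N"
      then show ?thesis using bracket_N by (intro exI[of _ 1]) simp
    qed
  qed
  then show ?thesis using span_superset by blast
qed

lemma dim_le_twice: "dim R \<le> 2 * k"
  using dim_le_of_kernel_sub[of "{..<k}" "\<lambda>i x. c x i"] weight_add weight_scale zero_weights_in_N
  by simp

text \<open>If no such \<open>x\<close> existed, the other \<open>k - 1\<close> weights would already cut out \<open>N\<close>, giving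
  \<open>dim R \<le> 2 k - 1\<close>.\<close>

lemma ex_dual_element:
  assumes dim: "dim R = 2 * k" and j: "j < k"
  shows "\<exists>x\<in>R. \<forall>i<k. c x i = (if i = j then 1 else 0)"
proof -
  have "\<exists>y\<in>R. y \<notin> N \<and> (\<forall>i\<in>{..<k} - {j}. c y i = 0)"
  proof (rule ccontr)
    assume none: "\<not> ?thesis"
    have "dim R \<le> card ({..<k} - {j}) + k"
    proof (rule dim_le_of_kernel_sub[of "{..<k} - {j}" "\<lambda>i x. c x i"])
      show "x \<in> N" if "x \<in> R" "\<And>i. i \<in> {..<k} - {j} \<Longrightarrow> c x i = 0" for x
        using none that by blast
    qed (auto simp: weight_add weight_scale)
    then show False using dim j by simp
  qed
  then obtain y where y: "y \<in> R" "y \<notin> N" "\<And>i. i < k \<Longrightarrow> i \<noteq> j \<Longrightarrow> c y i = 0" by auto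
  have "c y j \<noteq> 0" using zero_weights_in_N[OF y(1)] y(2,3) by metis
  then show ?thesis
    using y weight_scale subspace_scale[OF subspace_L y(1)]
    by (intro bexI[of _ "scale (inverse (c y j)) y"]) auto
qed

text \<open>The element \<open>xj\<close> dual to the \<open>j\<close>-th weight has the eigenvalue \<open>1\<close> on \<open>N\<close> with multiplicity one.
  Its eigenspace is therefore a line, which the commuting actions of \<open>R\<close> preserve.\<close>

context
  fixes j xj
  assumes j: "j < k" and xj: "xj \<in> R" and dual: "\<And>i. i < k \<Longrightarrow> c xj i = (if i = j then 1 else 0)"
begin

text \<open>On the span of the vectors before \<open>v j\<close> the action \<open>T\<close> of \<open>xj\<close> is strictly triangular, so its
  \<open>j\<close>-th power vanishes there. As \<open>T (v j) - v j\<close> lies in that span, \<open>T^j (v j)\<close> is fixed by \<open>T\<close>.\<close>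

definition eigenvector :: 'a where
  "eigenvector = ((\<lambda>n. br n xj) ^^ j) (v j)"

text \<open>Applying \<open>xj\<close> to a vector erases its component along \<open>v m\<close> if the diagonal entry there is zero,
  so a fixed vector has no such component.\<close>

lemma fixed_vector_descends:
  assumes "u \<in> N" "br u xj = u" "u \<in> span (v ` {..<m})" "l \<le> m" "m \<le> k" "j \<notin> {l..<m}"
  shows "u \<in> span (v ` {..<l})"
  using assms(4,3,5,6)
proof (induction m rule: dec_induct)
  case (step m)
  have m: "m < k" "m \<noteq> j" using step by auto
  have "br u xj \<in> span (v ` {..<m})"
  proof (rule endomorphism_on_span_image[OF endomorphism_N[OF xj] subspace_N _ subspace_span _ step.prems(1)])
    show "v ` {..<Suc m} \<subseteq> N" using flag_N m by auto
    fix s assume "s \<in> v ` {..<Suc m}"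
    then obtain i where i: "i \<le> m" "s = v i" by (auto simp: less_Suc_eq_le)
    show "br s xj \<in> span (v ` {..<m})"
    proof (cases "i = m")
      case True
      then show ?thesis using weight_spec[OF m(1) xj] dual[OF m(1)] m(2) i by simp
    next
      case False
      then show ?thesis
        using triangular_step[OF tri[OF xj], of i] span_lessThan_mono[of "Suc i" m v] i m by auto
    qed
  qed
  then show ?case using step assms(2) by auto
qed

lemma eigenvector_leading: "eigenvector - v j \<in> span (v ` {..<j})"
proof -
  have "((\<lambda>n. br n xj) ^^ m) (v j) - v j \<in> span (v ` {..<j})" for m
  proof (induction m)
    case (Suc m)
    let ?w = "((\<lambda>n. br n xj) ^^ m) (v j)"
    have w: "?w \<in> N"
      using endomorphism_onD(1)[OF endomorphism_on_funpow[OF endomorphism_N[OF xj]] flag_N[OF j]] .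
    have "br (?w - v j) xj \<in> span (v ` {..<j})"
      using triangular_invariant[OF tri[OF xj] endomorphism_N[OF xj] subspace_N flag_N _ Suc] j
      by simp
    moreover have "br (?w - v j) xj = br ?w xj - br (v j) xj"
      using w flag_N[OF j] N_sub xj by (intro bracket_diff_left) auto
    moreover have "br (v j) xj - v j \<in> span (v ` {..<j})"
      using weight_spec[OF j xj] dual[OF j] by simp
    ultimately have "(br ?w xj - br (v j) xj) + (br (v j) xj - v j) \<in> span (v ` {..<j})"
      using span_add by metis
    then show ?case by simp
  qed (simp add: span_zero)
  then show ?thesis by (simp add: eigenvector_def)
qed

lemma eigenvector_N: "eigenvector \<in> N"
  unfolding eigenvector_def
  using endomorphism_onD(1)[OF endomorphism_on_funpow[OF endomorphism_N[OF xj]] flag_N[OF j]] .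

lemma eigenvector_nonzero: "eigenvector \<noteq> 0"
proof
  assume "eigenvector = 0"
  then have "v j \<in> span (v ` {..<j})" using eigenvector_leading span_neg by fastforce
  then show False using flag j by (simp add: flag_basis_def)
qed

lemma eigenvector_fixed: "br eigenvector xj = eigenvector"
proof -
  let ?T = "\<lambda>n. br n xj"
  note T = endomorphism_N[OF xj]
  have "?T (v j) - v j \<in> span (v ` {..<j})"
    using weight_spec[OF j xj] dual[OF j] by simp
  then have "(?T ^^ j) (?T (v j) - v j) = 0"
    using j dual
    by (intro triangular_zero_diagonal_funpow[OF tri[OF xj] T subspace_N flag_N]) auto
  moreover have "(?T ^^ j) (?T (v j) - v j) = (?T ^^ j) (?T (v j)) - (?T ^^ j) (v j)"
    using endomorphism_onD(1)[OF T] flag_N[OF j]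
    by (intro endomorphism_on_diff[OF endomorphism_on_funpow[OF T] subspace_N]) auto
  ultimately show ?thesis using funpow_swap1[of ?T j "v j"] by (simp add: eigenvector_def)
qed

lemma fixed_vector_multiple:
  assumes u: "u \<in> N" "br u xj = u"
  obtains a where "u = scale a eigenvector"
proof -
  have "u \<in> span (v ` {..<k})" using u flag by (simp add: flag_basis_def)
  then have "u \<in> span (v ` {..<Suc j})" using fixed_vector_descends[OF u] j by auto
  then obtain a where a: "u - scale a (v j) \<in> span (v ` {..<j})"
    by (auto simp: lessThan_Suc span_breakdown_eq)
  let ?w = "u - scale a eigenvector"
  have "(u - scale a (v j)) - scale a (eigenvector - v j) \<in> span (v ` {..<j})"
    by (rule span_diff[OF a span_scale[OF eigenvector_leading]])
  then have "?w \<in> span (v ` {..<j})" by (simp add: scale_right_diff_distrib)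
  moreover have "?w \<in> N" using u eigenvector_N subspace_N by (simp add: subspace_diff subspace_scale)
  moreover have "br ?w xj = ?w"
    using u eigenvector_N N_sub xj eigenvector_fixed subspace_scale[OF subspace_L]
      bracket_diff_left[OF xj, of u "scale a eigenvector"] bracket_scale_left[of eigenvector xj a]
    by (auto simp: subset_iff)
  ultimately have "?w \<in> span (v ` {..<0})" using fixed_vector_descends[of ?w j 0] j by simp
  then show thesis using that[of a] by simp
qed

lemma eigenvector_weight:
  assumes x: "x \<in> R"
  shows "br eigenvector x = scale (c x j) eigenvector"
proof -
  have "br (br eigenvector x) xj = br eigenvector x"
    using right_multiplications_commute[OF eigenvector_N x xj derived_in_nilradical[OF x xj]]
    by (simp add: eigenvector_fixed)
  then obtain a where a: "br eigenvector x = scale a eigenvector"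
    using fixed_vector_multiple N_right[OF eigenvector_N x] by metis
  have "br (eigenvector - v j) x \<in> span (v ` {..<j})"
    using triangular_invariant[OF tri[OF x] endomorphism_N[OF x] subspace_N flag_N _ eigenvector_leading] j
    by simp
  moreover have "br (eigenvector - v j) x = br eigenvector x - br (v j) x"
    using eigenvector_N flag_N[OF j] N_sub x by (intro bracket_diff_left) auto
  ultimately have "scale a (eigenvector - v j) - (scale a eigenvector - br (v j) x) \<in> span (v ` {..<j})"
    using eigenvector_leading a by (metis span_diff span_scale)
  then have "c x j = a" by (intro weight_eqI[OF j x]) (simp add: scale_right_diff_distrib)
  then show ?thesis using a by simp
qed

end

end

text \<open>Every dimension of \<open>R\<close> beyond \<open>N\<close> is detected by one of the \<open>k\<close> weights.\<close>

theorem dim_le: "dim R \<le> 2 * k"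
proof -
  obtain v c where "flag_basis N k v" "\<And>x. x \<in> R \<Longrightarrow> triangular_wrt v k (\<lambda>n. br n x) (c x)"
    using common_flag[OF order_refl derived_in_nilradical] by metis
  then show ?thesis by (rule dim_le_twice)
qed

end

section \<open>Splitting in the extremal case\<close>

text \<open>The shape of an extremal algebra before the complement is corrected: \<open>h i\<close> are the weights,
  \<open>e i\<close> a basis of \<open>N\<close> by weight vectors, and \<open>x i\<close> elements dual to the weights.\<close>

locale weight_basis = abelian_nilradical scale br R N k
  for scale :: "complex \<Rightarrow> 'a::ab_group_add \<Rightarrow> 'a" and br R N k +
  fixes e x :: "nat \<Rightarrow> 'a" and h :: "nat \<Rightarrow> 'a \<Rightarrow> complex"
  assumes e_N: "\<And>i. i < k \<Longrightarrow> e i \<in> N" and e_nonzero: "\<And>i. i < k \<Longrightarrow> e i \<noteq> 0"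
    and N_span: "N = span (e ` {..<k})"
    and x_R: "\<And>i. i < k \<Longrightarrow> x i \<in> R"
    and h_x: "\<And>i j. i < k \<Longrightarrow> j < k \<Longrightarrow> h i (x j) = (if i = j then 1 else 0)"
    and e_weight: "\<And>i y. i < k \<Longrightarrow> y \<in> R \<Longrightarrow> br (e i) y = scale (h i y) (e i)"
    and h_add: "\<And>i y z. i < k \<Longrightarrow> y \<in> R \<Longrightarrow> z \<in> R \<Longrightarrow> h i (y + z) = h i y + h i z"
    and h_scale: "\<And>i y a. i < k \<Longrightarrow> y \<in> R \<Longrightarrow> h i (scale a y) = a * h i y"
    and h_kernel: "\<And>y. y \<in> R \<Longrightarrow> \<forall>i<k. h i y = 0 \<Longrightarrow> y \<in> N"
begin

lemma e_R: "i < k \<Longrightarrow> e i \<in> R"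
  using e_N N_sub by blast

lemma h_N: "i < k \<Longrightarrow> n \<in> N \<Longrightarrow> h i n = 0"
  using e_weight[of i n] bracket_N[OF e_N, of i n] e_nonzero[of i] N_sub by auto

lemma h_diff: "i < k \<Longrightarrow> y \<in> R \<Longrightarrow> z \<in> R \<Longrightarrow> h i (y - z) = h i y - h i z"
  using h_add[of i "y - z" z] subspace_diff[OF subspace_L] by simp

lemma h_sum:
  assumes "i < k" "\<And>j. j \<in> I \<Longrightarrow> f j \<in> R"
  shows "h i (\<Sum>j\<in>I. f j) = (\<Sum>j\<in>I. h i (f j))"
  using assms
proof (induction I rule: infinite_finite_induct)
  case (insert j I)
  then show ?case using h_add[of i "f j" "sum f I"] subspace_sum[OF subspace_L, of I f] by simp
qed (use h_N subspace_0[OF subspace_N] in simp_all)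

lemma N_bracket_eqI:
  assumes z: "z \<in> R" and f: "endomorphism_on N f"
    and eq: "\<And>i. i < k \<Longrightarrow> br (e i) z = f (e i)" and n: "n \<in> N"
  shows "br n z = f n"
proof -
  have "endomorphism_on N (\<lambda>n. br n z - f n)"
    using endomorphism_onD[OF f] endomorphism_onD[OF endomorphism_N[OF z]] subspace_diff[OF subspace_N]
    unfolding endomorphism_on_def by (simp add: scale_right_diff_distrib)
  from endomorphism_on_span_image[OF this subspace_N, of "e ` {..<k}" "{0}" n]
  have "br n z - f n \<in> {0}" using eq e_N n N_span by auto
  then show ?thesis by simp
qed

text \<open>All weights take the value \<open>1\<close> on this element, so it acts on \<open>N\<close> as the identity.\<close>

definition unit_element :: 'a where
  "unit_element = (\<Sum>i<k. x i)"

lemma unit_element_R: "unit_element \<in> R"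
  unfolding unit_element_def using x_R by (intro subspace_sum[OF subspace_L]) auto

lemma bracket_unit_element:
  assumes "n \<in> N"
  shows "br n unit_element = n"
proof (rule N_bracket_eqI[OF unit_element_R _ _ assms])
  show "endomorphism_on N (\<lambda>n. n)" by (simp add: endomorphism_on_def)
  fix i assume i: "i < k"
  have "h i unit_element = (\<Sum>j<k. h i (x j))"
    unfolding unit_element_def using h_sum[OF i, of "{..<k}" x] x_R by simp
  also have "\<dots> = (\<Sum>j<k. if i = j then 1 else 0)" using h_x[OF i] by (intro sum.cong) auto
  also have "\<dots> = 1" using i by (simp add: sum.delta)
  finally show "br (e i) unit_element = e i" using e_weight[OF i unit_element_R] by simp
qed

text \<open>The bracket lies in \<open>N\<close>, where \<open>unit_element\<close> acts as the identity. Subtracting it projects \<open>x i\<close>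
  onto the elements that \<open>unit_element\<close> annihilates from the right and leaves all weights unchanged.\<close>

definition x' :: "nat \<Rightarrow> 'a" where
  "x' i = x i - br (x i) unit_element"

lemma x'_R: "i < k \<Longrightarrow> x' i \<in> R"
  unfolding x'_def using x_R unit_element_R bracket_closed subspace_diff[OF subspace_L] by simp

lemma h_x': "i < k \<Longrightarrow> j < k \<Longrightarrow> h i (x' j) = (if i = j then 1 else 0)"
  unfolding x'_def using h_diff[OF _ x_R bracket_closed[OF x_R unit_element_R]] h_x
    h_N[OF _ derived_in_nilradical[OF x_R unit_element_R]] by simp

lemma x'_bracket_unit_element:
  assumes "i < k"
  shows "br (x' i) unit_element = 0"
  unfolding x'_def
  using bracket_diff_left[OF unit_element_R x_R bracket_closed[OF x_R unit_element_R], OF assms assms]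
    bracket_unit_element[OF derived_in_nilradical[OF x_R unit_element_R]] assms by simp

text \<open>The derivation given by \<open>unit_element\<close> kills both factors, hence their bracket; but the bracket is in
  \<open>N\<close>, where this derivation is the identity.\<close>

lemma x'_bracket_x':
  assumes "i < k" "j < k"
  shows "br (x' i) (x' j) = 0"
proof -
  note R = x'_R[OF assms(1)] x'_R[OF assms(2)] unit_element_R
  have "br (x' i) (x' j) = br (br (x' i) (x' j)) unit_element"
    using bracket_unit_element[OF derived_in_nilradical[OF R(1,2)]] by simp
  also have "\<dots> = br (br (x' i) unit_element) (x' j) + br (x' i) (br (x' j) unit_element)"
    by (rule right_multiplication_derivation[OF R])
  also have "\<dots> = 0"
    using x'_bracket_unit_element assms bracket_zero_left bracket_zero_right R by simp
  finally show ?thesis .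
qed

lemma N_bracket_x':
  assumes "n \<in> N" "j < k"
  shows "br n (x' j) \<in> span {e j}"
proof (rule endomorphism_on_span_image[OF endomorphism_N[OF x'_R[OF assms(2)]] subspace_N _ subspace_span])
  show "e ` {..<k} \<subseteq> N" "n \<in> span (e ` {..<k})" using e_N assms(1) N_span by auto
  fix s assume "s \<in> e ` {..<k}"
  then obtain i where i: "i < k" "s = e i" by auto
  then show "br s (x' j) \<in> span {e j}"
    using e_weight[OF i(1) x'_R[OF assms(2)]] h_x'[OF i(1) assms(2)] by (auto simp: span_zero span_base)
qed

text \<open>Right multiplication by \<open>x' j\<close> fixes the bracket, and its image on \<open>N\<close> is the line of \<open>e j\<close>.\<close>

lemma x'_bracket_e_same_weight:
  assumes "i < k" "j < k"
  shows "br (x' i) (e j) \<in> span {e j}"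
proof -
  note R = x'_R[OF assms(1)] e_R[OF assms(2)] x'_R[OF assms(2)]
  have N: "br (x' i) (e j) \<in> N" using N_left e_N R assms by blast
  have "br (br (x' i) (e j)) (x' j) = br (br (x' i) (x' j)) (e j) + br (x' i) (br (e j) (x' j))"
    by (rule right_multiplication_derivation[OF R])
  also have "\<dots> = br (x' i) (e j)"
    using x'_bracket_x'[OF assms] bracket_zero_left[OF R(2)] e_weight[OF assms(2) R(3)]
      h_x'[OF assms(2) assms(2)] by simp
  finally show ?thesis using N_bracket_x'[OF N assms(2)] by simp
qed

text \<open>If \<open>[x' i, e j] = m e j\<close>, then the Leibniz identity for \<open>[x' i, [x' i, e j]]\<close> gives \<open>m^2 = 0\<close>,
  because \<open>x' i\<close> annihilates \<open>e j\<close> from the right when \<open>i\<close> and \<open>j\<close> differ.\<close>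

lemma x'_bracket_e:
  assumes "i < k" "j < k" "i \<noteq> j"
  shows "br (x' i) (e j) = 0"
proof -
  note R = x'_R[OF assms(1)] e_R[OF assms(2)]
  obtain m where m: "br (x' i) (e j) = scale m (e j)"
    using x'_bracket_e_same_weight[OF assms(1,2)] span_singleton by auto
  have ey: "br (e j) (x' i) = 0"
    using e_weight[OF assms(2) R(1)] h_x'[OF assms(2,1)] assms(3) by auto
  have "scale m (scale m (e j)) = br (x' i) (br (x' i) (e j))"
    using m bracket_scale_right[OF R] by simp
  also have "\<dots> = br (br (x' i) (x' i)) (e j) - br (br (x' i) (e j)) (x' i)"
    using leibniz_identity[OF R(1,1,2)] .
  also have "\<dots> = 0"
    using x'_bracket_x'[OF assms(1,1)] bracket_zero_left[OF R(2)] bracket_scale_left[OF R(2,1)] m ey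
    by simp
  finally have "m = 0" using e_nonzero[OF assms(2)] by simp
  then show ?thesis using m by simp
qed

definition block :: "nat \<Rightarrow> 'a set" where
  "block i = span {e i, x' i}"

lemma block_R: "i < k \<Longrightarrow> block i \<subseteq> R"
  unfolding block_def using e_R x'_R subspace_L by (intro span_minimal) auto

lemma block_bracket_block:
  assumes "i < k" "j < k" "i \<noteq> j" "u \<in> block i" "w \<in> block j"
  shows "br u w = 0"
proof -
  have "br u w \<in> {0}"
  proof (rule bracket_spans_in_subspace[OF _ _ subspace_single_0 _ assms(4,5)[unfolded block_def]])
    show "{e i, x' i} \<subseteq> R" "{e j, x' j} \<subseteq> R" using assms e_R x'_R by auto
    fix a b assume "a \<in> {e i, x' i}" "b \<in> {e j, x' j}"
    then show "br a b \<in> {0}"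
      using assms(1-3) bracket_N e_N x'_bracket_x' x'_bracket_e e_weight x'_R h_x' by auto
  qed
  then show ?thesis by simp
qed

lemma block_bracket_self:
  assumes "i < k" "u \<in> block i" "w \<in> block i"
  shows "br u w \<in> span {e i}"
proof (rule bracket_spans_in_subspace[OF _ _ subspace_span _ assms(2,3)[unfolded block_def]])
  show "{e i, x' i} \<subseteq> R" "{e i, x' i} \<subseteq> R" using assms e_R x'_R by auto
  fix a b assume "a \<in> {e i, x' i}" "b \<in> {e i, x' i}"
  then show "br a b \<in> span {e i}"
    using assms(1) bracket_N e_N x'_bracket_x' x'_bracket_e_same_weight e_weight x'_R h_x'
    by (auto simp: span_zero intro: span_base)
qed

lemma leibniz_algebra_block:
  assumes "i < k"
  shows "leibniz_algebra scale br (block i)"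
proof (rule leibniz_subalgebra[of "{e i, x' i}"])
  fix u w assume "u \<in> block i" "w \<in> block i"
  then have "br u w \<in> span {e i}" by (rule block_bracket_self[OF assms])
  also have "\<dots> \<subseteq> block i" unfolding block_def by (intro span_mono) simp
  finally show "br u w \<in> block i" .
qed (simp_all add: block_R[OF assms] block_def[symmetric])

lemma dim_block:
  assumes "i < k"
  shows "dim (block i) = 2"
proof -
  have "span {e i} \<subseteq> N" using e_N[OF assms] subspace_N by (intro span_minimal) auto
  moreover have "x' i \<notin> N" using h_N[OF assms] h_x'[OF assms assms] by auto
  ultimately have y: "x' i \<notin> span {e i}" by blast
  have "independent {x' i, e i}"
    by (rule independent_insertI[OF y]) (simp add: e_nonzero[OF assms])
  moreover have "x' i \<noteq> e i" using y span_base by blast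
  ultimately show ?thesis
    using dim_span_eq_card_independent[of "{x' i, e i}"] by (simp add: block_def insert_commute)
qed

lemma not_nilpotent_block:
  assumes "i < k"
  shows "\<not> nilpotent br (block i)"
proof -
  have mem: "e i \<in> block i" "x' i \<in> block i" by (auto simp: block_def intro: span_base)
  have ey: "br (e i) (x' i) = e i" using e_weight[OF assms x'_R[OF assms]] h_x'[OF assms assms] by simp
  have "e i \<in> lower_central br (block i) j" for j
  proof (induction j)
    case (Suc j)
    then show ?case using bracket_in_bracket_span[OF Suc mem(2), of br] ey by simp
  qed (simp add: mem)
  then have "lower_central br (block i) j \<noteq> {0}" for j using e_nonzero[OF assms] by auto
  then show ?thesis by (simp add: nilpotent_def)
qed

lemma solvable_block:
  assumes "i < k"
  shows "solvable br (block i)"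
proof -
  have "derived br (block i) 1 \<subseteq> span {e i}"
    using block_bracket_self[OF assms] by (simp add: bracket_span_sub)
  also have "\<dots> \<subseteq> N" using e_N[OF assms] subspace_N by (intro span_minimal) auto
  finally have "derived br (block i) (Suc 1) \<subseteq> {0}"
    unfolding derived.simps(2)[of _ _ 1] using bracket_N by (intro bracket_span_sub) auto
  moreover have "0 \<in> derived br (block i) (Suc 1)" by (simp add: bracket_span_def span_zero)
  ultimately have "derived br (block i) (Suc 1) = {0}" by blast
  then show ?thesis unfolding solvable_def by blast
qed

text \<open>The projection of \<open>R\<close> onto a block: bracketing with \<open>x' j\<close> extracts the component along \<open>e j\<close>, and
  the weight \<open>h j\<close> the one along \<open>x' j\<close>. Together
  these projections invert the summation map of the direct sum.\<close>

definition block_proj :: "nat \<Rightarrow> 'a \<Rightarrow> 'a" where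
  "block_proj j r = br r (x' j) + scale (h j r) (x' j)"

lemma endomorphism_on_block_proj: "j < k \<Longrightarrow> endomorphism_on R (block_proj j)"
  unfolding endomorphism_on_def block_proj_def
  using bracket_closed x'_R bracket_add_left bracket_scale_left h_add h_scale
    subspace_add[OF subspace_L] subspace_scale[OF subspace_L]
  by (simp add: scale_right_distrib scale_left_distrib algebra_simps)

lemma block_proj_on_block:
  assumes "i < k" "j < k" "u \<in> block i"
  shows "block_proj j u = (if i = j then u else 0)"
proof -
  have id: "endomorphism_on R (\<lambda>u. block_proj j u - (if i = j then u else 0))"
    using endomorphism_onD[OF endomorphism_on_block_proj[OF assms(2)]] subspace_diff[OF subspace_L]
    unfolding endomorphism_on_def by (simp add: scale_right_diff_distrib)
  have "block_proj j u - (if i = j then u else 0) \<in> {0}"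
  proof (rule endomorphism_on_span_image[OF id subspace_L _ subspace_single_0 _ assms(3)[unfolded block_def]])
    show "{e i, x' i} \<subseteq> R" using assms e_R x'_R by auto
    fix s assume "s \<in> {e i, x' i}"
    then show "block_proj j s - (if i = j then s else 0) \<in> {0}"
      using assms(1,2) h_N e_N x'_bracket_x' e_weight x'_R h_x' by (auto simp: block_proj_def)
  qed
  then show ?thesis by simp
qed

text \<open>Subtracting the combination of the \<open>x' i\<close> with the same weights leaves an element of \<open>N\<close>.\<close>

lemma spanned_by_blocks:
  assumes "r \<in> R"
  shows "r \<in> span (\<Union>i<k. block i)"
proof -
  let ?s = "\<Sum>i<k. scale (h i r) (x' i)"
  let ?U = "span (\<Union>i<k. block i)"
  have gen: "e i \<in> ?U" "x' i \<in> ?U" if "i < k" for i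
    using that span_superset[of "{e i, x' i}"] by (auto simp: block_def intro!: span_base)
  have sR: "?s \<in> R"
    using x'_R subspace_scale[OF subspace_L] by (intro subspace_sum[OF subspace_L]) auto
  have "r - ?s \<in> N"
  proof (rule h_kernel)
    show "r - ?s \<in> R" using assms sR subspace_diff[OF subspace_L] by blast
    show "\<forall>l<k. h l (r - ?s) = 0"
    proof (intro allI impI)
      fix l assume l: "l < k"
      have "h l ?s = (\<Sum>i<k. h l (scale (h i r) (x' i)))"
        using x'_R subspace_scale[OF subspace_L] by (intro h_sum[OF l]) auto
      also have "\<dots> = (\<Sum>i<k. if i = l then h i r else 0)"
        using h_scale[OF l x'_R] h_x'[OF l] by (intro sum.cong) auto
      also have "\<dots> = h l r" using l by (simp add: sum.delta)
      finally show "h l (r - ?s) = 0" using h_diff[OF l assms sR] by simp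
    qed
  qed
  moreover have "N \<subseteq> ?U" unfolding N_span using gen by (intro span_minimal subspace_span) auto
  moreover have "?s \<in> ?U" using gen by (intro span_sum span_scale) auto
  ultimately have "(r - ?s) + ?s \<in> ?U" using span_add by blast
  then show ?thesis by simp
qed

lemma blocks_R: "(\<Union>i<k. block i) \<subseteq> R"
  using block_R by (intro UN_least) simp

lemma block_proj_in_block:
  assumes "j < k" "r \<in> R"
  shows "block_proj j r \<in> block j"
proof (rule endomorphism_on_span_image[OF endomorphism_on_block_proj[OF assms(1)] subspace_L blocks_R
      _ _ spanned_by_blocks[OF assms(2)]])
  show "subspace (block j)" by (simp add: block_def)
  fix u assume "u \<in> (\<Union>i<k. block i)"
  then show "block_proj j u \<in> block j"
    using block_proj_on_block[OF _ assms(1)] by (auto simp: block_def span_zero)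
qed

lemma sum_block_proj:
  assumes "r \<in> R"
  shows "(\<Sum>j<k. block_proj j r) = r"
proof -
  have "endomorphism_on R (\<lambda>r. (\<Sum>j<k. block_proj j r) - r)"
    unfolding endomorphism_on_def
    using endomorphism_onD[OF endomorphism_on_block_proj] subspace_diff[OF subspace_L]
      subspace_sum[OF subspace_L, of "{..<k}"]
    by (simp add: sum.distrib scale_sum_right scale_right_diff_distrib)
  then have "(\<Sum>j<k. block_proj j r) - r \<in> {0}"
  proof (rule endomorphism_on_span_image[OF _ subspace_L blocks_R subspace_single_0 _ spanned_by_blocks[OF assms]])
    fix u assume "u \<in> (\<Union>i<k. block i)"
    then obtain i where i: "i < k" "u \<in> block i" by blast
    then have "(\<Sum>j<k. block_proj j u) = (\<Sum>j<k. if i = j then u else 0)"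
      using block_proj_on_block by (intro sum.cong) auto
    then show "(\<Sum>j<k. block_proj j u) - u \<in> {0}" using i by (simp add: sum.delta)
  qed
  then show ?thesis by simp
qed

lemma block_proj_sum:
  assumes f: "f \<in> Pi\<^sub>E {..<k} block" and j: "j < k"
  shows "block_proj j (\<Sum>i<k. f i) = f j"
proof -
  have fi: "f i \<in> block i" if "i < k" for i using f that by auto
  have "block_proj j (\<Sum>i\<in>I. f i) = (\<Sum>i\<in>I. block_proj j (f i))" if "I \<subseteq> {..<k}" for I
    using finite_subset[OF that finite_lessThan] that
  proof (induction I rule: finite_induct)
    case (insert i I)
    have "f i \<in> R" "sum f I \<in> R"
      using insert.prems fi block_R by (auto intro!: subspace_sum[OF subspace_L])
    then show ?case using insert endomorphism_onD(2)[OF endomorphism_on_block_proj[OF j]] by simp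
  qed (use endomorphism_on_zero[OF endomorphism_on_block_proj[OF j] subspace_L] in simp)
  from this[OF order_refl] have "block_proj j (\<Sum>i<k. f i) = (\<Sum>i<k. if i = j then f i else 0)"
    using block_proj_on_block[OF _ j fi] by (auto intro!: sum.cong)
  then show ?thesis using j by (simp add: sum.delta)
qed

lemma direct_sum_of_blocks: "is_direct_sum br R {..<k} block"
  unfolding is_direct_sum_def
proof (intro conjI ballI)
  show "subspace (block i)" for i by (simp add: block_def)
  show "bij_betw (\<lambda>f. \<Sum>i<k. f i) (Pi\<^sub>E {..<k} block) R"
  proof (rule bij_betwI[where g = "\<lambda>r. \<lambda>j\<in>{..<k}. block_proj j r"])
    show "(\<lambda>f. \<Sum>i<k. f i) \<in> Pi\<^sub>E {..<k} block \<rightarrow> R"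
      using block_R by (auto intro!: subspace_sum[OF subspace_L])
    show "(\<lambda>r. \<lambda>j\<in>{..<k}. block_proj j r) \<in> R \<rightarrow> Pi\<^sub>E {..<k} block" using block_proj_in_block by auto
    show "(\<lambda>j\<in>{..<k}. block_proj j (\<Sum>i<k. f i)) = f" if "f \<in> Pi\<^sub>E {..<k} block" for f
      using that block_proj_sum[OF that] by (intro PiE_ext[OF _ that]) auto
    show "(\<Sum>i<k. (\<lambda>j\<in>{..<k}. block_proj j r) i) = r" if "r \<in> R" for r
      using sum_block_proj[OF that] by simp
  qed
  fix f g assume f: "f \<in> Pi\<^sub>E {..<k} block" and g: "g \<in> Pi\<^sub>E {..<k} block"
  have R: "f i \<in> R" "g i \<in> R" if "i < k" for i using that f g block_R by auto
  have "br (\<Sum>i<k. f i) (\<Sum>i<k. g i) = (\<Sum>i<k. br (f i) (\<Sum>j<k. g j))"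
    using R by (intro bracket_sum_left) (auto intro!: subspace_sum[OF subspace_L])
  also have "\<dots> = (\<Sum>i<k. \<Sum>j<k. br (f i) (g j))"
    using R by (intro sum.cong refl bracket_sum_right) auto
  also have "\<dots> = (\<Sum>i<k. \<Sum>j<k. if i = j then br (f i) (g j) else 0)"
    using f g block_bracket_block by (intro sum.cong refl) (auto simp: PiE_iff)
  also have "\<dots> = (\<Sum>i<k. br (f i) (g i))" by (simp add: sum.delta)
  finally show "br (\<Sum>i<k. f i) (\<Sum>i<k. g i) = (\<Sum>i<k. br (f i) (g i))" .
qed simp

end

context abelian_nilradical
begin

lemma ex_weight_basis:
  assumes dim: "dim R = 2 * k"
  obtains e x h where "weight_basis scale br R N k e x h"
proof -
  obtain v c where flag: "flag_basis N k v"
    and tri: "\<And>x. x \<in> R \<Longrightarrow> triangular_wrt v k (\<lambda>n. br n x) (c x)"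
    using common_flag[OF order_refl derived_in_nilradical] by metis
  have "\<forall>j. \<exists>x. j < k \<longrightarrow> x \<in> R \<and> (\<forall>i<k. c x i = (if i = j then 1 else 0))"
    using ex_dual_element[OF flag tri dim] by metis
  then obtain x where x: "\<And>j. j < k \<Longrightarrow> x j \<in> R"
    "\<And>i j. j < k \<Longrightarrow> i < k \<Longrightarrow> c (x j) i = (if i = j then 1 else 0)" by metis
  define e where "e j = eigenvector v j (x j)" for j
  have "weight_basis scale br R N k e x (\<lambda>i y. c y i)"
  proof (intro weight_basis.intro weight_basis_axioms.intro)
    show "abelian_nilradical scale br R N k" by (rule abelian_nilradical_axioms)
  next
    fix i assume i: "i < k"
    note dual = x(2)[OF i]
    show "e i \<in> N" "e i \<noteq> 0"
      using eigenvector_N[OF flag tri i x(1)[OF i] dual] eigenvector_nonzero[OF flag tri i x(1)[OF i] dual]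
      by (auto simp: e_def)
    show "x i \<in> R" using x i by blast
    fix y assume y: "y \<in> R"
    show "br (e i) y = scale (c y i) (e i)"
      using eigenvector_weight[OF flag tri i x(1)[OF i] dual y] by (simp add: e_def)
    show "c (y + z) i = c y i + c z i" if "z \<in> R" for z using weight_add[OF flag tri i y that] .
    show "c (scale a y) i = a * c y i" for a using weight_scale[OF flag tri i y] .
  next
    have "span (v ` {..<k}) \<subseteq> span (e ` {..<k})"
      using eigenvector_leading[OF flag tri _ x(1) x(2)] flag_in_span_of_leading[of k e v k]
      by (simp add: e_def)
    moreover have "span (e ` {..<k}) \<subseteq> N"
      using eigenvector_N[OF flag tri _ x(1) x(2)]
      by (intro span_minimal subspace_N) (auto simp: e_def)
    ultimately show "N = span (e ` {..<k})" using flag by (auto simp: flag_basis_def)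
  qed (use x zero_weights_in_N[OF flag tri] in auto)
  then show thesis by (rule that)
qed

theorem ex_direct_sum_decomposition:
  assumes dim: "dim R = 2 * k"
  shows "\<exists>M. is_direct_sum br R {..<k} M \<and>
    (\<forall>i<k. leibniz_algebra scale br (M i) \<and> dim (M i) = 2 \<and>
      \<not> nilpotent br (M i) \<and> solvable br (M i))"
proof -
  obtain e x h where "weight_basis scale br R N k e x h" using dim by (rule ex_weight_basis)
  then interpret weight_basis scale br R N k e x h .
  show ?thesis
    using direct_sum_of_blocks leibniz_algebra_block dim_block not_nilpotent_block solvable_block
    by (intro exI[of _ block]) simp
qed

end

section \<open>An extremal example\<close>

text \<open>The direct sum of \<open>k\<close> copies of the two-dimensional algebra with basis \<open>a, b\<close> whose only
  nonzero product of basis vectors is \<open>[a, b] = a\<close>. It is realised on the sequences supported below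
  \<open>2 k\<close>: the positions below \<open>k\<close> hold the coefficients of the vectors \<open>a\<close>, and the position \<open>n + k\<close>
  holds the coefficient of the vector \<open>b\<close> that acts on position \<open>n\<close>.\<close>

definition pointwise_scale :: "complex \<Rightarrow> (nat \<Rightarrow> complex) \<Rightarrow> nat \<Rightarrow> complex" where
  "pointwise_scale c f = (\<lambda>n. c * f n)"

definition supported_below :: "nat \<Rightarrow> (nat \<Rightarrow> complex) set" where
  "supported_below m = {f. \<forall>n\<ge>m. f n = 0}"

definition unit_vector :: "nat \<Rightarrow> nat \<Rightarrow> complex" where
  "unit_vector i = (\<lambda>n. if n = i then 1 else 0)"

definition model_bracket :: "nat \<Rightarrow> (nat \<Rightarrow> complex) \<Rightarrow> (nat \<Rightarrow> complex) \<Rightarrow> nat \<Rightarrow> complex" where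
  "model_bracket k f g = (\<lambda>n. if n < k then f n * g (n + k) else 0)"

interpretation seq: complex_vector_space pointwise_scale
  by unfold_locales (auto simp: pointwise_scale_def fun_eq_iff algebra_simps)

lemma subspace_supported_below: "seq.subspace (supported_below m)"
  by (rule seq.subspaceI) (auto simp: supported_below_def pointwise_scale_def)

lemma span_unit_vectors: "seq.span (unit_vector ` {..<m}) = supported_below m"
proof
  show "seq.span (unit_vector ` {..<m}) \<subseteq> supported_below m"
    by (intro seq.span_minimal subspace_supported_below)
      (auto simp: supported_below_def unit_vector_def)
  have "f \<in> seq.span (unit_vector ` {..<m})" if "f \<in> supported_below m" for f
    using that
  proof (induction m arbitrary: f)
    case 0
    have "f = 0" using 0 by (auto simp: supported_below_def fun_eq_iff)
    show ?case unfolding \<open>f = 0\<close> by (rule seq.span_zero)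
  next
    case (Suc m)
    have "f - pointwise_scale (f m) (unit_vector m) \<in> supported_below m"
      using Suc.prems
      by (auto simp: supported_below_def pointwise_scale_def unit_vector_def Suc_le_eq)
    then show ?case using Suc.IH by (auto simp: lessThan_Suc seq.span_breakdown_eq)
  qed
  then show "supported_below m \<subseteq> seq.span (unit_vector ` {..<m})" by blast
qed

lemma dim_supported_below: "seq.dim (supported_below m) = m"
proof -
  have "unit_vector i \<notin> seq.span (unit_vector ` {..<i})" for i
    unfolding span_unit_vectors by (simp add: supported_below_def unit_vector_def)
  then have "seq.independent (unit_vector ` {..<m})" "card (unit_vector ` {..<m}) = m"
    using seq.independent_of_flag[of m unit_vector] by auto
  then show ?thesis
    using seq.dim_span_eq_card_independent[of "unit_vector ` {..<m}"] by (simp add: span_unit_vectors)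
qed

lemma leibniz_algebra_model:
  "leibniz_algebra pointwise_scale (model_bracket k) (supported_below (2 * k))"
proof
  show "\<exists>B. finite B \<and> seq.span B = supported_below (2 * k)"
    using span_unit_vectors by blast
qed (auto simp: model_bracket_def supported_below_def pointwise_scale_def fun_eq_iff algebra_simps)

lemma model_bracket_supported: "model_bracket k f g \<in> supported_below k"
  by (simp add: model_bracket_def supported_below_def)

lemma model_bracket_supported_zero: "g \<in> supported_below k \<Longrightarrow> model_bracket k f g = 0"
  by (simp add: model_bracket_def supported_below_def fun_eq_iff)

lemma solvable_model: "seq.solvable (model_bracket k) (supported_below (2 * k))"
proof -
  have "seq.derived (model_bracket k) (supported_below (2 * k)) 1 \<subseteq> supported_below k"
    using model_bracket_supported by (simp add: seq.bracket_span_sub subspace_supported_below)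
  then have "seq.derived (model_bracket k) (supported_below (2 * k)) (Suc 1) \<subseteq> {0}"
    unfolding seq.derived.simps(2)[of _ _ 1] using model_bracket_supported_zero
    by (intro seq.bracket_span_sub seq.subspace_single_0) auto
  moreover have "0 \<in> seq.derived (model_bracket k) (supported_below (2 * k)) (Suc 1)"
    by (simp add: seq.bracket_span_def seq.span_zero)
  ultimately have "seq.derived (model_bracket k) (supported_below (2 * k)) (Suc 1) = {0}" by blast
  then show ?thesis unfolding seq.solvable_def by blast
qed

text \<open>An element with a nonzero coefficient at \<open>m + k\<close> reproduces the unit vector at \<open>m\<close> up to a
  nonzero factor. An ideal containing the element contains this unit vector, which then survives
  in every term of the lower central series.\<close>

lemma nilpotent_ideal_of_model:
  assumes J: "seq.ideal_of (model_bracket k) (supported_below (2 * k)) J"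
    and nil: "seq.nilpotent (model_bracket k) J"
  shows "J \<subseteq> supported_below k"
proof (rule ccontr)
  assume "\<not> J \<subseteq> supported_below k"
  then obtain f n where f: "f \<in> J" "n \<ge> k" "f n \<noteq> 0" by (auto simp: supported_below_def)
  have JR: "J \<subseteq> supported_below (2 * k)" and subJ: "seq.subspace J"
    using J by (auto simp: seq.ideal_of_def)
  define m where "m = n - k"
  have "f \<in> supported_below (2 * k)" using f(1) JR by blast
  then have "\<not> 2 * k \<le> n" using f(3) by (auto simp: supported_below_def)
  then have "n < 2 * k" by simp
  then have m: "m < k" "f (m + k) \<noteq> 0" using f by (auto simp: m_def)
  have br: "pointwise_scale (inverse (f (m + k))) (model_bracket k (unit_vector m) f) = unit_vector m"
    using m by (auto simp: fun_eq_iff model_bracket_def unit_vector_def pointwise_scale_def)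
  have "unit_vector m \<in> supported_below (2 * k)"
    using m by (simp add: supported_below_def unit_vector_def)
  then have "model_bracket k (unit_vector m) f \<in> J" using J f(1) by (simp add: seq.ideal_of_def)
  from seq.subspace_scale[OF subJ this, of "inverse (f (m + k))"]
  have mJ: "unit_vector m \<in> J" unfolding br .
  have "unit_vector m \<in> seq.lower_central (model_bracket k) J j" for j
  proof (induction j)
    case (Suc j)
    have "model_bracket k (unit_vector m) f
        \<in> seq.bracket_span (model_bracket k) (seq.lower_central (model_bracket k) J j) J"
      using Suc f(1) by (rule seq.bracket_in_bracket_span)
    then have "pointwise_scale (inverse (f (m + k))) (model_bracket k (unit_vector m) f)
        \<in> seq.bracket_span (model_bracket k) (seq.lower_central (model_bracket k) J j) J"
      unfolding seq.bracket_span_def by (rule seq.span_scale)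
    then show ?case unfolding br by simp
  qed (simp add: mJ)
  moreover have "unit_vector m \<noteq> 0" by (auto simp: unit_vector_def fun_eq_iff)
  ultimately show False using nil unfolding seq.nilpotent_def by blast
qed

lemma model_has_abelian_nilradical:
  "solvable_with_abelian_nilradical k pointwise_scale (model_bracket k) (supported_below (2 * k))"
proof -
  let ?N = "supported_below k"
  have "?N \<subseteq> supported_below (2 * k)" by (auto simp: supported_below_def)
  then have "seq.ideal_of (model_bracket k) (supported_below (2 * k)) ?N"
    using model_bracket_supported subspace_supported_below by (simp add: seq.ideal_of_def)
  moreover have "seq.nilpotent (model_bracket k) ?N"
  proof -
    have "seq.bracket_span (model_bracket k) ?N ?N \<subseteq> {0}"
      using model_bracket_supported_zero by (intro seq.bracket_span_sub) auto
    then have "seq.lower_central (model_bracket k) ?N 1 \<subseteq> {0}" by simp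
    moreover have "0 \<in> seq.lower_central (model_bracket k) ?N 1"
      by (simp add: seq.bracket_span_def seq.span_zero)
    ultimately have "seq.lower_central (model_bracket k) ?N 1 = {0}" by blast
    then show ?thesis unfolding seq.nilpotent_def by blast
  qed
  ultimately have "seq.is_nilradical (model_bracket k) (supported_below (2 * k)) ?N"
    using nilpotent_ideal_of_model by (simp add: seq.is_nilradical_def)
  moreover have "seq.is_abelian_algebra k (model_bracket k) ?N"
    using subspace_supported_below dim_supported_below model_bracket_supported_zero
    by (simp add: seq.is_abelian_algebra_def)
  ultimately show ?thesis
    unfolding solvable_with_abelian_nilradical_def
    using leibniz_algebra_model solvable_model by blast
qed

section \<open>Maximal dimension and decomposition\<close>

lemma abelian_nilradicalE:
  assumes "solvable_with_abelian_nilradical k scale br R"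
  obtains N where "abelian_nilradical scale br R N k"
proof -
  obtain N where "leibniz_algebra scale br R" "complex_vector_space.solvable scale br R"
    "complex_vector_space.is_nilradical scale br R N"
    "complex_vector_space.is_abelian_algebra scale k br N"
    using assms unfolding solvable_with_abelian_nilradical_def by auto
  then have "abelian_nilradical scale br R N k"
    by (intro abelian_nilradical.intro abelian_nilradical_axioms.intro)
  then show thesis by (rule that)
qed

theorem theorem3p2:
  fixes k :: nat
  assumes "k \<ge> 1"
  shows
    "(\<forall>(scale :: complex \<Rightarrow> 'a::ab_group_add \<Rightarrow> 'a) br R.
        solvable_with_abelian_nilradical k scale br R \<longrightarrow>
          vector_space.dim scale R \<le> 2 * k \<and> complement_dim k scale R \<le> int k)
     \<and> (\<exists>(scale :: complex \<Rightarrow> (nat \<Rightarrow> complex) \<Rightarrow> (nat \<Rightarrow> complex)) br R.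
        solvable_with_abelian_nilradical k scale br R \<and>
          vector_space.dim scale R = 2 * k \<and> complement_dim k scale R = int k)
     \<and> (\<forall>(scale :: complex \<Rightarrow> 'a \<Rightarrow> 'a) br R.
        solvable_with_abelian_nilradical k scale br R \<and> complement_dim k scale R = int k \<longrightarrow>
          (\<exists>M :: nat \<Rightarrow> 'a set.
             complex_vector_space.is_direct_sum scale br R {..<k} M \<and>
             (\<forall>i<k. leibniz_algebra scale br (M i) \<and> vector_space.dim scale (M i) = 2 \<and>
                \<not> complex_vector_space.nilpotent scale br (M i) \<and>
                complex_vector_space.solvable scale br (M i))))"
proof (intro conjI allI impI)
  fix scale :: "complex \<Rightarrow> 'a \<Rightarrow> 'a" and br R
  assume "solvable_with_abelian_nilradical k scale br R"
  then obtain N where "abelian_nilradical scale br R N k" by (rule abelian_nilradicalE)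
  then show "vector_space.dim scale R \<le> 2 * k" by (rule abelian_nilradical.dim_le)
  then show "complement_dim k scale R \<le> int k" by (simp add: complement_dim_def)
next
  have "complement_dim k pointwise_scale (supported_below (2 * k)) = int k"
    by (simp add: complement_dim_def dim_supported_below)
  then show "\<exists>(scale :: complex \<Rightarrow> (nat \<Rightarrow> complex) \<Rightarrow> (nat \<Rightarrow> complex)) br R.
      solvable_with_abelian_nilradical k scale br R \<and>
        vector_space.dim scale R = 2 * k \<and> complement_dim k scale R = int k"
    using model_has_abelian_nilradical dim_supported_below by blast
next
  fix scale :: "complex \<Rightarrow> 'a \<Rightarrow> 'a" and br R
  assume asm: "solvable_with_abelian_nilradical k scale br R \<and> complement_dim k scale R = int k"
  then obtain N where "abelian_nilradical scale br R N k" using abelian_nilradicalE by blast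
  moreover have "vector_space.dim scale R = 2 * k" using asm by (simp add: complement_dim_def)
  ultimately show "\<exists>M :: nat \<Rightarrow> 'a set.
      complex_vector_space.is_direct_sum scale br R {..<k} M \<and>
      (\<forall>i<k. leibniz_algebra scale br (M i) \<and> vector_space.dim scale (M i) = 2 \<and>
         \<not> complex_vector_space.nilpotent scale br (M i) \<and>
         complex_vector_space.solvable scale br (M i))"
    by (rule abelian_nilradical.ex_direct_sum_decomposition)
qed

end
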